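(* Let $X$ be an infinite-dimensional Banach space over $\mathbb{K}\in\{\mathbb{R},\mathbb{C}\}$ and let $n\ge3$. Then $\mathcal{L}_s(^nX;\mathbb{K})$ fails the sequential $w^*$-KK.
   Context: $\mathcal{L}_s(^nX;\mathbb{K})$ is the Banach space of continuous symmetric $n$-linear forms $A:X^n\to\mathbb{K}$ with norm $\|A\|=\sup\{|A(x_1,\dots,x_n)|:x_j\in B_X\}$. It is isometrically the dual of $\widetilde\otimes_\pi^{n,s}X$, the range of the symmetrization projection on the completed $n$-fold projective tensor product $\widetilde\otimes_\pi^nX$ with the inherited norm, and carries the corresponding weak-star topology (on bounded nets: pointwise convergence on $X^n$). A dual space $E^*$ with fixed predual $E$ has the sequential $w^*$-KK (sequential weak-star Kadec--Klee property) if, whenever $(x^*_m)\subseteq S_{E^*}$ is a sequence, $x^*\in S_{E^*}$ and $x^*_m\to x^*$ weak-star, then $\|x^*_m-x^*\|\to0$. *)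

theory Defs
  imports "HOL-Analysis.Analysis"
begin

text \<open>
  A Banach space over K (the reals or the complex numbers) is modelled by a type of class banach,
  the underlying real Banach space, together with a scalar multiplication by K that extends the
  real one and is compatible with the norm.
\<close>

locale normed_space_over = vector_space smul
  for smul :: "'k::real_normed_field \<Rightarrow> 'x::real_normed_vector \<Rightarrow> 'x" +
  assumes smul_of_real: "smul (of_real r) x = r *\<^sub>R x"
    and norm_smul: "norm (smul a x) = norm a * norm x"

definition infinite_dimensional ::
    "('k::real_normed_field \<Rightarrow> 'x::real_normed_vector \<Rightarrow> 'x) \<Rightarrow> bool" where
  "infinite_dimensional smul \<longleftrightarrow> \<not> (\<exists>B. finite B \<and> module.span smul B = UNIV)"

text \<open>
  A point of the n-fold product of X is a function on the naturals of which only the values at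
  indices below n matter. Hence a form on that product is required to depend only on the
  restriction of its argument to these indices.
\<close>

type_synonym ('x, 'k) form = "(nat \<Rightarrow> 'x) \<Rightarrow> 'k"

definition multilinear_forms ::
    "('k::real_normed_field \<Rightarrow> 'x::real_normed_vector \<Rightarrow> 'x) \<Rightarrow> nat \<Rightarrow> ('x, 'k) form set" where
  "multilinear_forms smul n =
     {A. (\<forall>x y. (\<forall>i<n. x i = y i) \<longrightarrow> A x = A y) \<and>
         (\<forall>i<n. \<forall>x. Vector_Spaces.linear smul (*) (\<lambda>t. A (x(i := t))))}"

text \<open>
  Continuity refers to the product topology on the function type; because of the restriction
  above this is joint continuity on the n-fold product.
\<close>

definition continuous_forms ::
    "('k::real_normed_field \<Rightarrow> 'x::real_normed_vector \<Rightarrow> 'x) \<Rightarrow> nat \<Rightarrow> ('x, 'k) form set" where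
  "continuous_forms smul n = {A \<in> multilinear_forms smul n. continuous_on UNIV A}"

definition symmetric_forms ::
    "('k::real_normed_field \<Rightarrow> 'x::real_normed_vector \<Rightarrow> 'x) \<Rightarrow> nat \<Rightarrow> ('x, 'k) form set" where
  "symmetric_forms smul n =
     {A \<in> continuous_forms smul n. \<forall>\<sigma> x. \<sigma> permutes {..<n} \<longrightarrow> A (x \<circ> \<sigma>) = A x}"

definition form_norm ::
    "nat \<Rightarrow> ('x::real_normed_vector, 'k::real_normed_field) form \<Rightarrow> real" where
  "form_norm n A = (SUP x \<in> {x. \<forall>i<n. norm (x i) \<le> 1}. norm (A x))"

text \<open>
  The algebraic tensor product is realised as the span of the evaluation functionals
  (the elementary tensors) on the space of all n-linear forms, continuous or not. Functionals are
  set to 0 outside their domain, so that equality of functions is equality of tensors.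
\<close>

type_synonym ('x, 'k) tensor = "('x, 'k) form \<Rightarrow> 'k"

definition tensor_sum ::
    "('k::real_normed_field \<Rightarrow> 'x::real_normed_vector \<Rightarrow> 'x) \<Rightarrow> nat \<Rightarrow>
     nat \<Rightarrow> (nat \<Rightarrow> 'k) \<Rightarrow> (nat \<Rightarrow> nat \<Rightarrow> 'x) \<Rightarrow> ('x, 'k) tensor" where
  "tensor_sum smul n p c x =
     (\<lambda>B. if B \<in> multilinear_forms smul n then \<Sum>k<p. c k * B (x k) else 0)"

definition algebraic_tensors ::
    "('k::real_normed_field \<Rightarrow> 'x::real_normed_vector \<Rightarrow> 'x) \<Rightarrow> nat \<Rightarrow> ('x, 'k) tensor set" where
  "algebraic_tensors smul n = {tensor_sum smul n p c x | p c x. True}"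

definition projective_norm ::
    "('k::real_normed_field \<Rightarrow> 'x::real_normed_vector \<Rightarrow> 'x) \<Rightarrow> nat \<Rightarrow> ('x, 'k) tensor \<Rightarrow> real" where
  "projective_norm smul n u =
     Inf {\<Sum>k<p. norm (c k) * (\<Prod>i<n. norm (x k i)) | p c x. u = tensor_sum smul n p c x}"

text \<open>
  The completion for the projective norm. The dual of the algebraic tensor product with the
  projective norm is the space of continuous n-linear forms, so an element of the completion is
  determined by its values on these: the class of a Cauchy sequence is identified with the
  functional sending a continuous n-linear form to the limit of the values along the sequence.
\<close>

definition completed_tensors ::
    "('k::real_normed_field \<Rightarrow> 'x::real_normed_vector \<Rightarrow> 'x) \<Rightarrow> nat \<Rightarrow> ('x, 'k) tensor set" where
  "completed_tensors smul n =
     {\<phi>. \<exists>u. (\<forall>k. u k \<in> algebraic_tensors smul n) \<and>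
             (\<forall>e>0. \<exists>N. \<forall>k\<ge>N. \<forall>l\<ge>N. projective_norm smul n (\<lambda>B. u k B - u l B) < e) \<and>
             (\<forall>A \<in> continuous_forms smul n. (\<lambda>k. u k A) \<longlonglongrightarrow> \<phi> A) \<and>
             (\<forall>A. A \<notin> continuous_forms smul n \<longrightarrow> \<phi> A = 0)}"

text \<open>
  The symmetrization projection sends an elementary tensor to the average of the elementary
  tensors obtained by permuting its factors; on functionals this is composition with the
  symmetrization of forms.
\<close>

definition symmetrize_form ::
    "nat \<Rightarrow> ('x::real_normed_vector, 'k::real_normed_field) form \<Rightarrow> ('x, 'k) form" where
  "symmetrize_form n A = (\<lambda>x. (\<Sum>\<sigma> | \<sigma> permutes {..<n}. A (x \<circ> \<sigma>)) / fact n)"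

definition symmetrization ::
    "('k::real_normed_field \<Rightarrow> 'x::real_normed_vector \<Rightarrow> 'x) \<Rightarrow> nat \<Rightarrow>
     ('x, 'k) tensor \<Rightarrow> ('x, 'k) tensor" where
  "symmetrization smul n \<phi> =
     (\<lambda>A. if A \<in> continuous_forms smul n then \<phi> (symmetrize_form n A) else 0)"

definition symmetric_tensors ::
    "('k::real_normed_field \<Rightarrow> 'x::real_normed_vector \<Rightarrow> 'x) \<Rightarrow> nat \<Rightarrow> ('x, 'k) tensor set" where
  "symmetric_tensors smul n = symmetrization smul n ` completed_tensors smul n"

text \<open>
  Weak-star convergence of symmetric forms is convergence of the duality pairing with every
  element of the predual, the completed symmetric projective tensor product.
\<close>

definition weak_star_tendsto ::
    "('k::real_normed_field \<Rightarrow> 'x::real_normed_vector \<Rightarrow> 'x) \<Rightarrow> nat \<Rightarrow>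
     (nat \<Rightarrow> ('x, 'k) form) \<Rightarrow> ('x, 'k) form \<Rightarrow> bool" where
  "weak_star_tendsto smul n F A \<longleftrightarrow>
     (\<forall>\<phi> \<in> symmetric_tensors smul n. (\<lambda>m. \<phi> (F m)) \<longlonglongrightarrow> \<phi> A)"

definition symmetric_forms_sequential_weak_star_KK ::
    "('k::real_normed_field \<Rightarrow> 'x::real_normed_vector \<Rightarrow> 'x) \<Rightarrow> nat \<Rightarrow> bool" where
  "symmetric_forms_sequential_weak_star_KK smul n \<longleftrightarrow>
     (\<forall>F A. (\<forall>m. F m \<in> symmetric_forms smul n \<and> form_norm n (F m) = 1) \<longrightarrow>
            A \<in> symmetric_forms smul n \<longrightarrow> form_norm n A = 1 \<longrightarrow>
            weak_star_tendsto smul n F A \<longrightarrow>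
            (\<lambda>m. form_norm n (\<lambda>x. F m x - A x)) \<longlonglongrightarrow> 0)"

end

theory Submission
  imports Defs
begin

text \<open>
  Let \<open>\<psi> m\<close> be a weak-star null sequence of functionals which are bounded away from 0 in norm
  (Josefson-Nissenzweig), and let \<open>\<phi>\<close>, \<open>h\<close> be functionals with \<open>|\<phi>|\<^sup>2 + |h|\<^sup>2 \<le> 1\<close> on the unit
  ball, \<open>\<phi>\<close> of norm 1 and \<open>h \<noteq> 0\<close>. On the unit ball the product of the \<open>|\<phi> (x i)|\<close> falls
  below 1 by at least a constant times the sum of the \<open>|h (x i)|\<^sup>2\<close>. Since \<open>n \<ge> 3\<close>, this leaves
  room to add a small multiple of the symmetrized product of \<open>\<psi> m\<close> with \<open>n - 1\<close> copies of \<open>h\<close>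
  without leaving the unit ball. The sums, normalized, converge weak-star to the product of the
  \<open>\<phi> (x i)\<close>, but not in norm.

  For the Josefson-Nissenzweig theorem choose functionals \<open>f n\<close> each of which vanishes on a finite
  set half-norming the midpoint combinations of the earlier ones. If they do not tend to 0
  pointwise, they are, after passing to a subsequence, bounded below at some point, which keeps
  combinations of early and late ones apart in norm. Now either repeated merging (taking midpoints
  along two subsequences) makes the pointwise oscillation arbitrarily small, and differences along
  a diagonal sequence are weak-star null; or a fixed oscillation persists, and halving along it
  builds a binary tree whose Rademacher averages are weak-star null by Bessel's inequality.
\<close>

section \<open>The Hahn-Banach theorem\<close>

text \<open>Homogeneity is asked only as an inequality for positive factors: the inverse factor
  turns it into an equality, and the factor 2 then forces the value 0 at 0.\<close>

definition sublinear :: "('a::real_vector \<Rightarrow> real) \<Rightarrow> bool" where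
  "sublinear p \<longleftrightarrow> (\<forall>x y. p (x + y) \<le> p x + p y) \<and> (\<forall>r>0. \<forall>x. p (r *\<^sub>R x) \<le> r * p x)"

lemma sublinear_add: "sublinear p \<Longrightarrow> p (x + y) \<le> p x + p y"
  by (simp add: sublinear_def)

lemma sublinear_scaleR_le: "sublinear p \<Longrightarrow> r > 0 \<Longrightarrow> p (r *\<^sub>R x) \<le> r * p x"
  by (simp add: sublinear_def)

lemma sublinear_scaleR:
  assumes "sublinear p" "r > 0"
  shows "p (r *\<^sub>R x) = r * p x"
proof -
  have "p (inverse r *\<^sub>R (r *\<^sub>R x)) \<le> inverse r * p (r *\<^sub>R x)"
    using assms by (intro sublinear_scaleR_le) auto
  then have "r * p x \<le> p (r *\<^sub>R x)"
    using assms(2) by (simp add: field_simps)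
  then show ?thesis
    using sublinear_scaleR_le[OF assms, of x] by simp
qed

lemma sublinear_zero: "sublinear p \<Longrightarrow> p 0 = 0"
  using sublinear_scaleR[of p 2 0] by simp

lemma sublinear_uminus: "sublinear p \<Longrightarrow> - p (- x) \<le> p x"
  using sublinear_add[of p x "- x"] sublinear_zero[of p] by simp

text \<open>Take the infimum of \<open>p (x + t *\<^sub>R a) - t * p a\<close> over
  \<open>t \<ge> 0\<close>. Subadditivity and homogeneity bound it below by
  \<open>- p (- x)\<close>; \<open>t = 0\<close> gives \<open>q \<le> p\<close>, and
  \<open>t = 1\<close> at \<open>- a\<close> gives the last claim.\<close>

lemma sublinear_decrease:
  assumes p: "sublinear p"
  obtains q where "sublinear q" "q \<le> p" "q (- a) \<le> - p a"
proof -
  define T where "T x t = p (x + t *\<^sub>R a) - t * p a" for x t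
  define q where "q x = (INF t\<in>{0..}. T x t)" for x
  have low: "- p (- x) \<le> T x t" if "t \<ge> 0" for x t
  proof -
    have "p (t *\<^sub>R a) = t * p a"
      using that sublinear_scaleR[OF p, of t a] sublinear_zero[OF p] by (cases "t = 0") auto
    moreover have "p (t *\<^sub>R a) \<le> p (x + t *\<^sub>R a) + p (- x)"
      using sublinear_add[OF p, of "x + t *\<^sub>R a" "- x"] by simp
    ultimately show ?thesis by (simp add: T_def)
  qed
  have upper: "q x \<le> T x t" if "t \<ge> 0" for x t
    unfolding q_def using that low by (intro cINF_lower bdd_belowI2[where m = "- p (- x)"]) auto
  have greatest: "m \<le> q x" if "\<And>t. t \<ge> 0 \<Longrightarrow> m \<le> T x t" for m x
    unfolding q_def using that by (intro cINF_greatest) auto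
  have "sublinear q"
    unfolding sublinear_def
  proof (intro conjI allI impI)
    fix x y
    have *: "q (x + y) \<le> T x s + T y t" if "s \<ge> 0" "t \<ge> 0" for s t
    proof -
      have "q (x + y) \<le> T (x + y) (s + t)" using that by (intro upper) auto
      also have "\<dots> \<le> T x s + T y t"
        using sublinear_add[OF p, of "x + s *\<^sub>R a" "y + t *\<^sub>R a"]
        by (simp add: T_def algebra_simps)
      finally show ?thesis .
    qed
    have "q (x + y) - T y t \<le> q x" if "t \<ge> 0" for t
      using *[OF _ that] by (intro greatest) (simp add: algebra_simps)
    then have "q (x + y) - q x \<le> q y"
      by (intro greatest) (simp add: algebra_simps)
    then show "q (x + y) \<le> q x + q y" by simp
  next
    fix r :: real and x assume r: "r > 0"
    have "q (r *\<^sub>R x) / r \<le> q x"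
    proof (rule greatest)
      fix t :: real assume "t \<ge> 0"
      then have "q (r *\<^sub>R x) \<le> T (r *\<^sub>R x) (r * t)" using r by (intro upper) auto
      also have "\<dots> = r * T x t"
        using sublinear_scaleR[OF p r, of "x + t *\<^sub>R a"] by (simp add: T_def algebra_simps)
      finally show "q (r *\<^sub>R x) / r \<le> T x t" using r by (simp add: field_simps)
    qed
    then show "q (r *\<^sub>R x) \<le> r * q x" using r by (simp add: field_simps)
  qed
  moreover have "q \<le> p"
    using upper[of 0] by (auto simp: T_def le_fun_def)
  moreover have "q (- a) \<le> - p a"
    using upper[of 1 "- a"] sublinear_zero[OF p] by (simp add: T_def)
  ultimately show ?thesis by (rule that)
qed

text \<open>A minimal sublinear functional is linear, since it cannot be decreased at any \<open>- a\<close>.\<close>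

lemma sublinear_minimal:
  assumes p: "sublinear p"
  obtains f where "linear f" "f \<le> p"
proof -
  define A where "A = {q. sublinear q \<and> q \<le> p}"
  \<comment> \<open>The order is reversed, so that the maximal element given by Zorn's lemma is a
    minimal sublinear functional.\<close>
  define P where "P = (\<lambda>q u :: 'a \<Rightarrow> real. u \<le> q)"
  have po: "partial_order_on A (relation_of P A)"
    by (auto simp: P_def partial_order_on_def preorder_on_def relation_of_def
        intro!: refl_onI transI antisymI)
  have "\<exists>u\<in>A. \<forall>a\<in>C. P a u" if C: "C \<in> Chains (relation_of P A)" for C
  proof (cases "C = {}")
    case True
    then show ?thesis using p by (auto simp: A_def)
  next
    case False
    have CA: "sublinear q" "q \<le> p" if "q \<in> C" for q
      using C that by (auto simp: Chains_def relation_of_def A_def)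
    have chain: "q \<le> q' \<or> q' \<le> q" if "q \<in> C" "q' \<in> C" for q q'
      using C that by (auto simp: Chains_def relation_of_def P_def)
    define u where "u x = (INF q\<in>C. q x)" for x
    \<comment> \<open>This uniform bound keeps the infimum of a chain finite.\<close>
    have low: "- p (- x) \<le> q x" if "q \<in> C" for q x
      using sublinear_uminus[OF CA(1)[OF that], of x] CA(2)[OF that] le_funD[of q p "- x"] by simp
    have upper: "u x \<le> q x" if "q \<in> C" for q x
      unfolding u_def using that low by (intro cINF_lower bdd_belowI2[where m = "- p (- x)"]) auto
    have greatest: "m \<le> u x" if "\<And>q. q \<in> C \<Longrightarrow> m \<le> q x" for m x
      unfolding u_def using that False by (intro cINF_greatest) auto
    have "sublinear u"
      unfolding sublinear_def
    proof (intro conjI allI impI)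
      fix x y
      have *: "u (x + y) \<le> q x + q' y" if q: "q \<in> C" "q' \<in> C" for q q'
      proof -
        \<comment> \<open>A chain has a member below both \<open>q\<close> and \<open>q'\<close>, so
          subadditivity passes to the infimum.\<close>
        obtain r where r: "r \<in> C" "r \<le> q" "r \<le> q'" using chain[OF q] q by blast
        have "u (x + y) \<le> r (x + y)" by (rule upper[OF r(1)])
        also have "\<dots> \<le> r x + r y" by (rule sublinear_add[OF CA(1)[OF r(1)]])
        also have "\<dots> \<le> q x + q' y" using r(2,3) by (intro add_mono) (auto simp: le_fun_def)
        finally show ?thesis .
      qed
      have "u (x + y) - q' y \<le> u x" if "q' \<in> C" for q'
        using *[OF _ that] by (intro greatest) (simp add: algebra_simps)
      then have "u (x + y) - u x \<le> u y"
        by (intro greatest) (simp add: algebra_simps)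
      then show "u (x + y) \<le> u x + u y" by simp
    next
      fix r :: real and x assume r: "r > 0"
      have "u (r *\<^sub>R x) / r \<le> u x"
      proof (rule greatest)
        fix q assume q: "q \<in> C"
        have "u (r *\<^sub>R x) \<le> r * q x"
          using upper[OF q, of "r *\<^sub>R x"] sublinear_scaleR[OF CA(1)[OF q] r] by simp
        then show "u (r *\<^sub>R x) / r \<le> q x" using r by (simp add: field_simps)
      qed
      then show "u (r *\<^sub>R x) \<le> r * u x" using r by (simp add: field_simps)
    qed
    moreover have "u \<le> p"
    proof -
      obtain q where q: "q \<in> C" using False by blast
      then have "u \<le> q" using upper by (simp add: le_fun_def)
      with CA(2)[OF q] show ?thesis by simp
    qed
    ultimately show ?thesis using upper by (auto simp: A_def P_def le_fun_def)
  qed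
  from predicate_Zorn[OF po this] obtain f
    where f: "f \<in> A" and "\<forall>a\<in>A. P f a \<longrightarrow> a = f" by blast
  then have min: "q = f" if "sublinear q" "q \<le> f" for q
    using that by (force simp: A_def P_def)
  have sub: "sublinear f" and le: "f \<le> p" using f by (auto simp: A_def)
  \<comment> \<open>Decreasing \<open>f\<close> at \<open>- a\<close> gives back \<open>f\<close> by
    minimality, whence \<open>f (- a) \<le> - f a\<close>. Oddness turns the sublinear inequalities
    into equalities.\<close>
  have odd: "f (- a) = - f a" for a
  proof -
    obtain q where "sublinear q" "q \<le> f" "q (- a) \<le> - f a"
      using sublinear_decrease[OF sub] by metis
    then have "f (- a) \<le> - f a" using min by auto
    then show ?thesis using sublinear_uminus[OF sub, of "a"] by simp
  qed
  have "linear f"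
  proof (rule linearI)
    fix x y
    have "f (- x + - y) \<le> f (- x) + f (- y)" by (rule sublinear_add[OF sub])
    then have "f x + f y \<le> f (x + y)" using odd[of x] odd[of y] odd[of "x + y"] by simp
    then show "f (x + y) = f x + f y" using sublinear_add[OF sub, of x y] by simp
  next
    fix r x
    have "f (r *\<^sub>R x) = - f ((- r) *\<^sub>R x)" using odd[of "r *\<^sub>R x"] by simp
    then show "f (r *\<^sub>R x) = r *\<^sub>R f x"
      using sublinear_scaleR[OF sub, of r x] sublinear_scaleR[OF sub, of "- r" x] sublinear_zero[OF sub]
      by (cases r "0::real" rule: linorder_cases) auto
  qed
  then show ?thesis using le by (rule that)
qed

text \<open>After \<open>p\<close> is decreased at \<open>- a\<close>, every linear functional
  \<open>f\<close> below the result satisfies \<open>f (- a) \<le> - p a\<close>, which is the bound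
  \<open>f a \<ge> p a\<close>.\<close>

lemma sublinear_Hahn_Banach:
  assumes p: "sublinear p"
  obtains f where "linear f" "f \<le> p" "f a = p a"
proof -
  obtain q where q: "sublinear q" "q \<le> p" "q (- a) \<le> - p a"
    using sublinear_decrease[OF p] by metis
  obtain f where f: "linear f" "f \<le> q" using sublinear_minimal[OF q(1)] .
  have "f (- a) \<le> q (- a)" using f(2) by (rule le_funD)
  then have "p a \<le> f a" using q(3) linear_neg[OF f(1), of a] by simp
  moreover have "f \<le> p" using f(2) q(2) by simp
  ultimately show ?thesis using f(1) le_funD[of f p a] by (intro that[of f]) auto
qed

section \<open>Functionals annihilating a closed subspace\<close>

definition dual_ball :: "('a::real_normed_vector \<Rightarrow> real) set" where
  "dual_ball = {f. linear f \<and> (\<forall>x. \<bar>f x\<bar> \<le> norm x)}"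

text \<open>Hahn-Banach is applied to the distance from \<open>S\<close>, which is sublinear, at
  most the norm, and 0 on \<open>S\<close>. Hence \<open>f a\<close> is the distance of
  \<open>a\<close> from \<open>S\<close>, and a nearly best approximation of \<open>a\<close> shows
  that \<open>f\<close> has norm at least 1/2.\<close>

lemma annihilator_exists:
  fixes S :: "'a::real_normed_vector set"
  assumes S: "subspace S" "closed S" and a: "a \<notin> S"
  obtains f y where "f \<in> dual_ball" "\<And>x. x \<in> S \<Longrightarrow> f x = 0" "f a \<noteq> 0" "norm y \<le> 1" "f y \<ge> 1/2"
proof -
  have ne: "S \<noteq> {}" using subspace_0[OF S(1)] by blast
  have approx: "\<exists>s\<in>S. dist x s < infdist x S + e" if "e > 0" for x e
  proof -
    have "infdist x S < infdist x S + e" using that by simp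
    then show ?thesis unfolding infdist_notempty[OF ne, of x]
      by (subst (asm) cINF_less_iff) (use ne in \<open>auto intro: bdd_belowI2[where m=0]\<close>)
  qed
  have sub: "sublinear (\<lambda>x. infdist x S)"
    unfolding sublinear_def
  proof (intro conjI allI impI)
    fix x y
    show "infdist (x + y) S \<le> infdist x S + infdist y S"
    proof (rule field_le_epsilon)
      fix e :: real assume "e > 0"
      then obtain s t where st: "s \<in> S" "t \<in> S"
        "dist x s < infdist x S + e/2" "dist y t < infdist y S + e/2"
        using approx[of "e/2" x] approx[of "e/2" y] by auto
      have "infdist (x + y) S \<le> dist (x + y) (s + t)"
        using st S(1) by (intro infdist_le subspace_add)
      also have "\<dots> \<le> dist x s + dist y t" by (rule dist_triangle_add)
      finally show "infdist (x + y) S \<le> infdist x S + infdist y S + e" using st by linarith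
    qed
  next
    fix r :: real and x assume r: "r > 0"
    show "infdist (r *\<^sub>R x) S \<le> r * infdist x S"
    proof (rule field_le_epsilon)
      fix e :: real assume "e > 0"
      then obtain s where s: "s \<in> S" "dist x s < infdist x S + e/r"
        using approx[of "e/r" x] r by auto
      have "infdist (r *\<^sub>R x) S \<le> dist (r *\<^sub>R x) (r *\<^sub>R s)"
        using s S(1) by (intro infdist_le subspace_scale)
      also have "\<dots> = r * dist x s"
        using r by (simp add: dist_norm flip: scaleR_diff_right)
      finally show "infdist (r *\<^sub>R x) S \<le> r * infdist x S + e"
        using s r by (simp add: field_simps)
    qed
  qed
  obtain f where f: "linear f" "f \<le> (\<lambda>x. infdist x S)" "f a = infdist a S"
    using sublinear_Hahn_Banach[OF sub] .
  have le: "f x \<le> infdist x S" for x using f(2) by (rule le_funD)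
  have normle: "infdist x S \<le> norm x" for x :: 'a
    using infdist_le[OF subspace_0[OF S(1)], of x] by simp
  have absle: "\<bar>f x\<bar> \<le> norm x" for x
    using order_trans[OF le normle, of x] order_trans[OF le normle, of "- x"] linear_neg[OF f(1), of x]
    by simp
  have zero: "f x = 0" if "x \<in> S" for x
    using le[of x] le[of "- x"] that subspace_neg[OF S(1) that] linear_neg[OF f(1), of x] by simp
  have pos: "infdist a S > 0"
    using a S(2) ne by (simp add: infdist_pos_not_in_closed)
  \<comment> \<open>An approximation within twice the distance leaves the value 1/2 after
    normalization of \<open>a - s\<close>.\<close>
  then obtain s where s: "s \<in> S" "dist a s < 2 * infdist a S"
    using approx[of "infdist a S" a] by auto
  have fd: "f (a - s) = infdist a S" using zero[OF s(1)] f by (simp add: linear_diff)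
  have npos: "norm (a - s) > 0" using a s(1) by auto
  define y where "y = (1 / norm (a - s)) *\<^sub>R (a - s)"
  have "f y = infdist a S / norm (a - s)" using fd by (simp add: y_def linear_scale[OF f(1)])
  also have "\<dots> \<ge> 1/2" using s(2) npos by (simp add: dist_norm field_simps)
  finally have "f y \<ge> 1/2" .
  moreover have "norm y \<le> 1" by (simp add: y_def)
  ultimately show ?thesis
    using that[of f y] f absle zero pos by (auto simp: dual_ball_def)
qed

text \<open>In the induction, let \<open>f\<close> kill \<open>span B\<close> but not
  \<open>a\<close>. The larger span is the preimage of \<open>span B\<close> under the continuous
  map that subtracts \<open>(f x / f a) *\<^sub>R a\<close> from \<open>x\<close>.\<close>

lemma closed_span_finite:
  fixes B :: "'a::real_normed_vector set"
  assumes "finite B"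
  shows "closed (span B)"
  using assms
proof induction
  case empty
  then show ?case by simp
next
  case (insert a B)
  show ?case
  proof (cases "a \<in> span B")
    case True
    then show ?thesis using insert by (simp add: span_redundant)
  next
    case False
    then obtain f where f: "f \<in> dual_ball" "\<And>x. x \<in> span B \<Longrightarrow> f x = 0" "f a \<noteq> 0"
      using annihilator_exists[OF subspace_span insert.IH] by metis
    have lin: "linear f" using f(1) by (simp add: dual_ball_def)
    have "bounded_linear f"
      using f(1) by (auto simp: dual_ball_def linear_linear bounded_linear_def bounded_linear_axioms_def
          intro!: exI[of _ 1])
    then have cf: "continuous_on UNIV f" by (rule linear_continuous_on)
    have cont: "continuous_on UNIV (\<lambda>x. x - (f x / f a) *\<^sub>R a)"
      using f(3) by (intro continuous_intros cf) auto
    have "span (insert a B) = (\<lambda>x. x - (f x / f a) *\<^sub>R a) -` span B"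
    proof (intro set_eqI iffI)
      fix x assume "x \<in> span (insert a B)"
      then obtain k where k: "x - k *\<^sub>R a \<in> span B" by (auto simp: span_insert)
      have "f x = k * f a" using f(2)[OF k] lin by (simp add: linear_diff linear_scale)
      then show "x \<in> (\<lambda>x. x - (f x / f a) *\<^sub>R a) -` span B" using k f(3) by simp
    qed (auto simp: span_insert)
    then show ?thesis using continuous_closed_vimage[OF insert.IH, of "\<lambda>x. x - (f x / f a) *\<^sub>R a"] cont
      by (simp add: continuous_on_eq_continuous_at)
  qed
qed

section \<open>The Josefson-Nissenzweig theorem\<close>

lemma dual_ball_linear: "f \<in> dual_ball \<Longrightarrow> linear f"
  by (simp add: dual_ball_def)

lemma dual_ball_abs_le: "f \<in> dual_ball \<Longrightarrow> \<bar>f x\<bar> \<le> norm x"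
  by (simp add: dual_ball_def)

lemma dual_ball_midpoint:
  assumes "u \<in> dual_ball" "v \<in> dual_ball"
  shows "(\<lambda>x. (u x + v x) / 2) \<in> dual_ball"
proof -
  have "\<bar>(u x + v x) / 2\<bar> \<le> norm x" for x
    using dual_ball_abs_le[OF assms(1), of x] dual_ball_abs_le[OF assms(2), of x]
    by (simp add: abs_le_iff)
  moreover have "linear (\<lambda>x. (u x + v x) / 2)"
    using assms by (intro linearI) (auto simp: dual_ball_def linear_add linear_scale algebra_simps add_divide_distrib)
  ultimately show ?thesis by (simp add: dual_ball_def)
qed

lemma dual_ball_half_diff:
  assumes "u \<in> dual_ball" "v \<in> dual_ball"
  shows "(\<lambda>x. (u x - v x) / 2) \<in> dual_ball"
proof -
  have "(\<lambda>x. - v x) \<in> dual_ball"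
    using assms(2) by (auto simp: dual_ball_def intro: linear_compose_neg)
  from dual_ball_midpoint[OF assms(1) this] show ?thesis by simp
qed

text \<open>Midpoints replace general convex combinations because a finite set has only finitely
  many of them, so that the hull can be exhausted by finite stages.\<close>

inductive_set midpoint_hull :: "('a \<Rightarrow> real) set \<Rightarrow> ('a \<Rightarrow> real) set" for S where
  base: "f \<in> S \<Longrightarrow> f \<in> midpoint_hull S"
| mid: "u \<in> midpoint_hull S \<Longrightarrow> v \<in> midpoint_hull S \<Longrightarrow> (\<lambda>x. (u x + v x) / 2) \<in> midpoint_hull S"

lemma midpoint_hull_mono:
  assumes "f \<in> midpoint_hull S" "S \<subseteq> T"
  shows "f \<in> midpoint_hull T"
  using assms by induction (auto intro: midpoint_hull.intros)

lemma midpoint_hull_minimal: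
  assumes "f \<in> midpoint_hull S" "S \<subseteq> T"
    and "\<And>u v. u \<in> T \<Longrightarrow> v \<in> T \<Longrightarrow> (\<lambda>x. (u x + v x) / 2) \<in> T"
  shows "f \<in> T"
  using assms by induction auto

lemma midpoint_hull_bounds:
  assumes "f \<in> midpoint_hull S" "\<And>g. g \<in> S \<Longrightarrow> l \<le> g x \<and> g x \<le> r"
  shows "l \<le> f x \<and> f x \<le> r"
  using assms(1) by induction (use assms(2) in force)+

text \<open>The norm of a functional need not be attained on the unit ball; half of it is always
  reached, also by the zero functional.\<close>

definition half_normed_at :: "('a::real_normed_vector \<Rightarrow> real) \<Rightarrow> 'a \<Rightarrow> bool" where
  "half_normed_at g y \<longleftrightarrow> norm y \<le> 1 \<and> (\<forall>x. norm x \<le> 1 \<longrightarrow> \<bar>g x\<bar> \<le> 2 * \<bar>g y\<bar>)"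

lemma half_normed_at_exists:
  assumes "g \<in> dual_ball"
  shows "\<exists>y. half_normed_at g y"
proof -
  define s where "s = (SUP x\<in>{x. norm x \<le> 1}. \<bar>g x\<bar>)"
  have bdd: "bdd_above ((\<lambda>x. \<bar>g x\<bar>) ` {x. norm x \<le> 1})"
    using dual_ball_abs_le[OF assms] by (intro bdd_aboveI2[where M = 1]) (force intro: order_trans)
  have upper: "\<bar>g x\<bar> \<le> s" if "norm x \<le> 1" for x
    unfolding s_def using that by (intro cSUP_upper bdd) auto
  show ?thesis
  proof (cases "s > 0")
    case True
    then have "s / 2 < s" by simp
    then obtain y where "norm y \<le> 1" "s / 2 < \<bar>g y\<bar>"
      unfolding s_def by (subst (asm) less_cSUP_iff) (use bdd in \<open>auto intro: exI[of _ 0]\<close>)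
    then show ?thesis using upper by (fastforce simp: half_normed_at_def)
  next
    case False
    then have "\<forall>x. norm x \<le> 1 \<longrightarrow> \<bar>g x\<bar> \<le> 0" using upper by force
    then have "half_normed_at g 0" by (auto simp: half_normed_at_def)
    then show ?thesis ..
  qed
qed

text \<open>A recursion on triples of the current functional, a finite set \<open>G\<close> of
  functionals and a finite set \<open>E\<close> of points. Each step adds to \<open>E\<close>
  half-norming points for all of \<open>G\<close>, takes a new functional vanishing on the enlarged
  \<open>E\<close>, which exists in infinite dimension, and adds it and all midpoints of
  \<open>G\<close> to \<open>G\<close>. Then \<open>M\<close> is the union of the sets
  \<open>G\<close>.\<close>

lemma annihilating_sequence:
  assumes inf: "\<nexists>B :: 'a::real_normed_vector set. finite B \<and> span B = UNIV"
  obtains f :: "nat \<Rightarrow> 'a::real_normed_vector \<Rightarrow> real" and M where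
    "\<forall>n. f n \<in> dual_ball \<and> (\<exists>x. norm x \<le> 1 \<and> \<bar>f n x\<bar> \<ge> 1/2) \<and> f n \<in> M"
    "\<forall>u\<in>M. \<forall>v\<in>M. (\<lambda>x. (u x + v x) / 2) \<in> M"
    "\<forall>g\<in>M. \<exists>y m. half_normed_at g y \<and> (\<forall>n\<ge>m. f n y = 0)"
proof -
  define P :: "('a \<Rightarrow> real) \<times> ('a \<Rightarrow> real) set \<times> 'a set \<Rightarrow> bool" where
    "P = (\<lambda>(f, G, E). f \<in> dual_ball \<and> (\<exists>x. norm x \<le> 1 \<and> \<bar>f x\<bar> \<ge> 1/2) \<and> f \<in> G \<and>
       finite G \<and> G \<subseteq> dual_ball \<and> finite E)"
  define Q :: "('a \<Rightarrow> real) \<times> ('a \<Rightarrow> real) set \<times> 'a set \<Rightarrow>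
      ('a \<Rightarrow> real) \<times> ('a \<Rightarrow> real) set \<times> 'a set \<Rightarrow> bool" where
    "Q = (\<lambda>(f, G, E) (f', G', E'). G \<subseteq> G' \<and> (\<forall>u\<in>G. \<forall>v\<in>G. (\<lambda>x. (u x + v x) / 2) \<in> G') \<and>
       E \<subseteq> E' \<and> (\<forall>g\<in>G. \<exists>y\<in>E'. half_normed_at g y) \<and> (\<forall>x\<in>E'. f' x = 0))"
  have ann: "\<exists>f\<in>dual_ball. (\<exists>x. norm x \<le> 1 \<and> \<bar>f x\<bar> \<ge> 1/2) \<and> (\<forall>x\<in>E. f x = 0)"
    if E: "finite E" for E :: "'a set"
  proof -
    obtain a where "a \<notin> span E" using inf E by blast
    then obtain f y where "f \<in> dual_ball" "\<And>x. x \<in> span E \<Longrightarrow> f x = 0" "norm y \<le> 1" "f y \<ge> 1/2"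
      using annihilator_exists[OF subspace_span closed_span_finite[OF E]] by metis
    then show ?thesis by (metis abs_ge_self order_trans span_base)
  qed
  have "\<exists>z. P z"
  proof -
    obtain f :: "'a \<Rightarrow> real" where "f \<in> dual_ball" "\<exists>x. norm x \<le> 1 \<and> \<bar>f x\<bar> \<ge> 1/2"
      using ann[of "{}"] by auto
    then have "P (f, {f}, {})" by (auto simp: P_def)
    then show ?thesis ..
  qed
  moreover have "\<exists>z'. P z' \<and> Q z z'" if "P z" for z
  proof -
    obtain f G E where z: "z = (f, G, E)" by (cases z)
    have G: "finite G" "G \<subseteq> dual_ball" "finite E" using that by (auto simp: P_def z)
    obtain Y where Y: "\<And>g. g \<in> G \<Longrightarrow> half_normed_at g (Y g)"
      using half_normed_at_exists G(2) by (metis subsetD)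
    define E' where "E' = E \<union> Y ` G"
    have E': "finite E'" using G by (simp add: E'_def)
    obtain f' where f': "f' \<in> dual_ball" "\<exists>x. norm x \<le> 1 \<and> \<bar>f' x\<bar> \<ge> 1/2" "\<forall>x\<in>E'. f' x = 0"
      using ann[OF E'] by blast
    define G' where "G' = insert f' (G \<union> (\<lambda>(u, v) x. (u x + v x) / 2) ` (G \<times> G))"
    have "G' \<subseteq> dual_ball" using G f'(1) by (auto simp: G'_def intro!: dual_ball_midpoint)
    then have "P (f', G', E')" using G f' E' by (auto simp: P_def G'_def)
    moreover have "Q z (f', G', E')" using Y f'(3) by (force simp: Q_def z G'_def E'_def)
    ultimately show ?thesis by blast
  qed
  ultimately obtain s where s: "\<And>n. P (s n)" "\<And>n. Q (s n) (s (Suc n))"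
    using dependent_nat_choice[of "\<lambda>_. P" "\<lambda>_. Q"] by metis
  define f where "f n = fst (s n)" for n
  define G where "G n = fst (snd (s n))" for n
  define E where "E n = snd (snd (s n))" for n
  have sn: "s n = (f n, G n, E n)" for n by (simp add: f_def G_def E_def)
  have P: "f n \<in> dual_ball" "\<exists>x. norm x \<le> 1 \<and> \<bar>f n x\<bar> \<ge> 1/2" "f n \<in> G n" for n
    using s(1)[of n] by (auto simp: sn P_def)
  have Q: "G n \<subseteq> G (Suc n)" "\<And>u v. u \<in> G n \<Longrightarrow> v \<in> G n \<Longrightarrow> (\<lambda>x. (u x + v x) / 2) \<in> G (Suc n)"
    "E n \<subseteq> E (Suc n)" "\<And>g. g \<in> G n \<Longrightarrow> \<exists>y\<in>E (Suc n). half_normed_at g y"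
    "\<And>x. x \<in> E (Suc n) \<Longrightarrow> f (Suc n) x = 0" for n
    using s(2)[of n] by (auto simp: sn Q_def)
  have Gmono: "G m \<subseteq> G n" and Emono: "E m \<subseteq> E n" if "m \<le> n" for m n
    using lift_Suc_mono_le[of G, OF Q(1) that] lift_Suc_mono_le[of E, OF Q(3) that] .
  show ?thesis
  proof
    show "\<forall>n. f n \<in> dual_ball \<and> (\<exists>x. norm x \<le> 1 \<and> \<bar>f n x\<bar> \<ge> 1/2) \<and> f n \<in> (\<Union>n. G n)"
      using P by blast
    show "\<forall>u\<in>\<Union>n. G n. \<forall>v\<in>\<Union>n. G n. (\<lambda>x. (u x + v x) / 2) \<in> (\<Union>n. G n)"
    proof (intro ballI)
      fix u v assume uv: "u \<in> (\<Union>n. G n)" "v \<in> (\<Union>n. G n)"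
      obtain i j where "u \<in> G i" "v \<in> G j" using uv by auto
      then have "u \<in> G (max i j)" "v \<in> G (max i j)"
        using Gmono[of i "max i j"] Gmono[of j "max i j"] by auto
      then show "(\<lambda>x. (u x + v x) / 2) \<in> (\<Union>n. G n)" using Q(2) by blast
    qed
    show "\<forall>g\<in>\<Union>n. G n. \<exists>y m. half_normed_at g y \<and> (\<forall>n\<ge>m. f n y = 0)"
    proof
      fix g assume g: "g \<in> (\<Union>n. G n)"
      obtain i where "g \<in> G i" using g by auto
      then obtain y where y: "y \<in> E (Suc i)" "half_normed_at g y" using Q(4) by blast
      \<comment> \<open>The functional of stage \<open>Suc k\<close> vanishes on
        \<open>E (Suc k)\<close>, which includes the points of \<open>E (Suc i)\<close>.\<close>
      have "f n y = 0" if "n \<ge> Suc i" for n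
      proof -
        obtain k where n: "n = Suc k" using \<open>n \<ge> Suc i\<close> by (cases n) auto
        show ?thesis using Emono[OF that] y(1) Q(5)[of y k] n by blast
      qed
      with y(2) show "\<exists>y m. half_normed_at g y \<and> (\<forall>n\<ge>m. f n y = 0)" by blast
    qed
  qed
qed

section \<open>Merging and oscillation of sequences\<close>

definition merges :: "(nat \<Rightarrow> 'a \<Rightarrow> real) \<Rightarrow> (nat \<Rightarrow> 'a \<Rightarrow> real) \<Rightarrow> bool" where
  "merges H H' \<longleftrightarrow> (\<exists>a b. strict_mono a \<and> strict_mono b \<and> H' = (\<lambda>k x. (H (a k) x + H (b k) x) / 2))"

text \<open>A strictly increasing index map satisfies \<open>a k \<ge> k\<close>, so repeated
  merging never brings terms of index below \<open>k\<close> into the \<open>k\<close>-th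
  one.\<close>

lemma merges_midpoint_hull:
  assumes "merges\<^sup>*\<^sup>* H H'"
  shows "H' k \<in> midpoint_hull (H ` {k..})"
  using assms
proof (induction arbitrary: k)
  case base
  then show ?case by (auto intro: midpoint_hull.base)
next
  case (step H' H'')
  then obtain a b where ab: "strict_mono a" "strict_mono b" and
    H'': "H'' = (\<lambda>k x. (H' (a k) x + H' (b k) x) / 2)" by (auto simp: merges_def)
  have "H' (a k) \<in> midpoint_hull (H ` {k..})" "H' (b k) \<in> midpoint_hull (H ` {k..})"
    using step.IH[of "a k"] step.IH[of "b k"] ab[THEN strict_mono_imp_increasing, of k]
    by (auto elim!: midpoint_hull_mono)
  then show ?case unfolding H'' by (rule midpoint_hull.mid)
qed

text \<open>The gap is demanded at every index and not only in the limit, so that the two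
  subsequences can be merged at once. It exists whenever upper and lower limit at some point of the
  unit ball differ by more than \<open>c\<close>.\<close>

definition oscillates :: "real \<Rightarrow> (nat \<Rightarrow> 'a::real_normed_vector \<Rightarrow> real) \<Rightarrow> bool" where
  "oscillates c H \<longleftrightarrow> (\<exists>x a b. norm x \<le> 1 \<and> strict_mono a \<and> strict_mono b \<and>
     (\<forall>k::nat. H (a k) x - H (b k) x \<ge> c))"

text \<open>Otherwise there are pairs of arbitrarily late indices with gap at least
  \<open>c\<close>; thinned out to increasing subsequences, they witness the oscillation.\<close>

lemma not_oscillates:
  assumes "\<not> oscillates c H" "norm x \<le> 1"
  obtains N where "\<forall>p\<ge>N. \<forall>q\<ge>N. H p x - H q x < c"
proof -
  have "\<exists>N. \<forall>p\<ge>N. \<forall>q\<ge>N. H p x - H q x < c"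
  proof (rule ccontr)
    assume "\<not> ?thesis"
    then have "\<forall>N. \<exists>p q. p \<ge> N \<and> q \<ge> N \<and> H p x - H q x \<ge> c" by (force simp: not_less)
    then obtain p q where pq: "\<And>N. p N \<ge> N" "\<And>N. q N \<ge> N" "\<And>N. H (p N) x - H (q N) x \<ge> c"
      by metis
    \<comment> \<open>Each stage starts beyond both indices of the previous pair, which makes both
      index sequences strictly increasing.\<close>
    define s where "s = rec_nat 0 (\<lambda>_ m. Suc (max (p m) (q m)))"
    have s: "s (Suc k) = Suc (max (p (s k)) (q (s k)))" for k by (simp add: s_def)
    have "p (s k) < p (s (Suc k))" "q (s k) < q (s (Suc k))" for k
      using pq(1,2)[of "s (Suc k)"] unfolding s[of k] by (auto simp: max_def split: if_splits)
    then have "strict_mono (p \<circ> s)" "strict_mono (q \<circ> s)" by (auto simp: strict_mono_Suc_iff)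
    with pq(3) assms show False unfolding oscillates_def comp_def by blast
  qed
  then show ?thesis using that by blast
qed

text \<open>Bessel's inequality for the Rademacher functions, by induction along the merging tree.\<close>

lemma merging_tree_Bessel:
  fixes H :: "nat \<Rightarrow> nat \<Rightarrow> 'a::real_normed_vector \<Rightarrow> real" and a b :: "nat \<Rightarrow> nat \<Rightarrow> nat"
  assumes H0: "\<And>k. H 0 k \<in> dual_ball"
    and H: "\<And>j k z. H (Suc j) k z = (H j (a j k) z + H j (b j k) z) / 2"
    and gap: "\<And>j k. H j (a j k) (x j) - H j (b j k) (x j) \<ge> c"
  obtains G :: "nat \<Rightarrow> nat \<Rightarrow> nat \<Rightarrow> 'a::real_normed_vector \<Rightarrow> real"
    where "\<forall>J k. \<forall>j<J. G J j k \<in> dual_ball \<and> G J j k (x j) \<ge> c/2"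
    "\<forall>J k z. (\<Sum>j<J. (G J j k z)\<^sup>2) \<le> (norm z)\<^sup>2"
proof -
  \<comment> \<open>\<open>G J j k\<close> is the half-difference created at level \<open>j\<close>,
    averaged along the tree up to node \<open>k\<close> of level \<open>J\<close>: the
    \<open>j\<close>-th Rademacher average there. It is of interest for \<open>j < J\<close> and is
    0 otherwise.\<close>
  define G where "G = rec_nat (\<lambda>j k z. 0) (\<lambda>J G j k z.
     if j = J then (H J (a J k) z - H J (b J k) z) / 2 else (G j (a J k) z + G j (b J k) z) / 2)"
  have G: "G (Suc J) j k z = (if j = J then (H J (a J k) z - H J (b J k) z) / 2
     else (G J j (a J k) z + G J j (b J k) z) / 2)" for J j k z
    by (simp add: G_def)
  have Hball: "H j k \<in> dual_ball" for j k
  proof (induction j arbitrary: k)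
    case (Suc j)
    have "H (Suc j) k = (\<lambda>z. (H j (a j k) z + H j (b j k) z) / 2)" using H by auto
    then show ?case using dual_ball_midpoint[OF Suc Suc] by simp
  qed (rule H0)
  have Gball: "G J j k \<in> dual_ball \<and> G J j k (x j) \<ge> c/2" if "j < J" for J j k
    using that
  proof (induction J arbitrary: k)
    case (Suc J)
    show ?case
    proof (cases "j = J")
      case True
      then have "G (Suc J) j k = (\<lambda>z. (H J (a J k) z - H J (b J k) z) / 2)" using G by auto
      then show ?thesis using dual_ball_half_diff[OF Hball Hball] gap[of J k] True by simp
    next
      case False
      then have IH: "G J j k \<in> dual_ball \<and> G J j k (x j) \<ge> c/2" for k using Suc by auto
      have "G (Suc J) j k = (\<lambda>z. (G J j (a J k) z + G J j (b J k) z) / 2)" using G False by auto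
      moreover have "c/2 \<le> (G J j (a J k) (x j) + G J j (b J k) (x j)) / 2"
        using IH[of "a J k"] IH[of "b J k"] by simp
      ultimately show ?thesis using dual_ball_midpoint IH by metis
    qed
  qed simp
  \<comment> \<open>The square of \<open>H J k z\<close> is carried along for the induction: by the
    parallelogram law the squares of the merged value and of the new half-difference add up to the
    mean of the squares at the two merged nodes. Convexity of the square handles the older
    terms.\<close>
  have Bessel: "(H J k z)\<^sup>2 + (\<Sum>j<J. (G J j k z)\<^sup>2) \<le> (norm z)\<^sup>2" for J k z
  proof (induction J arbitrary: k)
    case 0
    then show ?case using power_mono[OF dual_ball_abs_le[OF H0, of k z], of 2] by simp
  next
    case (Suc J)
    have conv: "((u + v) / 2)\<^sup>2 \<le> u\<^sup>2 / 2 + v\<^sup>2 / 2" for u v :: real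
      using zero_le_power2[of "u - v"] by (simp add: power2_eq_square field_simps)
    have par: "((u + v) / 2)\<^sup>2 + ((u - v) / 2)\<^sup>2 = u\<^sup>2 / 2 + v\<^sup>2 / 2" for u v :: real
      by (simp add: power2_eq_square field_simps)
    have "(\<Sum>j<J. (G (Suc J) j k z)\<^sup>2) \<le> (\<Sum>j<J. (G J j (a J k) z)\<^sup>2 / 2 + (G J j (b J k) z)\<^sup>2 / 2)"
      by (intro sum_mono) (simp add: G conv)
    also have "\<dots> = (\<Sum>j<J. (G J j (a J k) z)\<^sup>2) / 2 + (\<Sum>j<J. (G J j (b J k) z)\<^sup>2) / 2"
      by (simp add: sum.distrib sum_divide_distrib)
    finally show ?case
      using Suc.IH[of "a J k"] Suc.IH[of "b J k"] par[of "H J (a J k) z" "H J (b J k) z"]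
      by (simp add: G H)
  qed
  show ?thesis
  proof
    show "\<forall>J k. \<forall>j<J. G J j k \<in> dual_ball \<and> G J j k (x j) \<ge> c/2"
      using Gball by blast
    show "\<forall>J k z. (\<Sum>j<J. (G J j k z)\<^sup>2) \<le> (norm z)\<^sup>2"
      using Bessel by (meson add_increasing order_refl order_trans zero_le_power2)
  qed
qed

text \<open>Tychonoff's theorem gives a cluster point of \<open>Pt\<close> in a product of
  intervals. The index set may be uncountable, so convergence is along a filter finer than
  \<open>sequentially\<close> instead of along a subsequence.\<close>

lemma pointwise_cluster_filter:
  fixes Pt :: "nat \<Rightarrow> 'i \<Rightarrow> real"
  assumes "\<And>n i. \<bar>Pt n i\<bar> \<le> B i"
  obtains F g where "F \<noteq> bot" "F \<le> sequentially" "\<forall>i. ((\<lambda>n. Pt n i) \<longlongrightarrow> g i) F"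
proof -
  define K where "K = Pi\<^sub>E UNIV (\<lambda>i. {- B i..B i})"
  have "compactin (product_topology (\<lambda>i. euclidean) UNIV) K"
    unfolding K_def by (subst compactin_PiE) auto
  then have K: "compact K" by (simp add: euclidean_product_topology)
  have "Pt n \<in> K" for n using assms[of n] by (auto simp: K_def abs_le_iff minus_le_iff)
  then have "eventually (\<lambda>p. p \<in> K) (filtermap Pt sequentially)" by (simp add: eventually_filtermap)
  moreover have "filtermap Pt sequentially \<noteq> bot" by (simp add: filtermap_bot_iff)
  ultimately obtain g where g: "inf (nhds g) (filtermap Pt sequentially) \<noteq> bot"
    using K unfolding compact_filter by blast
  \<comment> \<open>This filter collects the indices at which \<open>Pt\<close> is near
    \<open>g\<close>, within every tail; it is proper because \<open>g\<close> is a cluster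
    point.\<close>
  define F where "F = inf (filtercomap Pt (nhds g)) sequentially"
  have "F \<noteq> bot"
  proof
    assume "F = bot"
    then have "eventually (\<lambda>n. False) (inf (filtercomap Pt (nhds g)) sequentially)" by (simp add: F_def)
    then obtain A A' where A: "eventually A (filtercomap Pt (nhds g))" "eventually A' sequentially"
        "\<And>n. A n \<and> A' n \<Longrightarrow> False"
      by (auto simp: eventually_inf)
    then obtain U where U: "eventually U (nhds g)" "\<And>n. U (Pt n) \<Longrightarrow> A n"
      by (auto simp: eventually_filtercomap)
    have "eventually (\<lambda>p. \<not> U p) (filtermap Pt sequentially)"
      unfolding eventually_filtermap using A(2) by eventually_elim (use U A in blast)
    with U(1) have "eventually (\<lambda>p. False) (inf (nhds g) (filtermap Pt sequentially))"
      unfolding eventually_inf by blast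
    with g show False by (simp add: eventually_False)
  qed
  moreover have "((\<lambda>n. Pt n i) \<longlongrightarrow> g i) F" for i
  proof -
    have "filterlim Pt (nhds g) (filtercomap Pt (nhds g))" by (rule filterlim_filtercomap)
    then have "(Pt \<longlongrightarrow> g) F" by (rule filterlim_mono) (auto simp: F_def)
    then show ?thesis
      by (rule continuous_on_tendsto_compose[OF continuous_on_product_coordinates]) auto
  qed
  ultimately show ?thesis by (intro that[of F g]) (auto simp: F_def)
qed

text \<open>Follow node 0 of level \<open>J\<close> along a filter on which \<open>J\<close> tends
  to infinity. Linearity, the bounds and Bessel's inequality pass to the limits, so the values
  \<open>g j z\<close> are square summable in \<open>j\<close> and tend to 0.\<close>

lemma merging_tree_weak_star_null:
  fixes H :: "nat \<Rightarrow> nat \<Rightarrow> 'a::real_normed_vector \<Rightarrow> real" and a b :: "nat \<Rightarrow> nat \<Rightarrow> nat"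
  assumes H0: "\<And>k. H 0 k \<in> dual_ball"
    and H: "\<And>j k z. H (Suc j) k z = (H j (a j k) z + H j (b j k) z) / 2"
    and gap: "\<And>j k. H j (a j k) (x j) - H j (b j k) (x j) \<ge> c"
  obtains g where "\<forall>j. g j \<in> dual_ball \<and> g j (x j) \<ge> c/2" "\<forall>z. (\<lambda>j. g j z) \<longlonglongrightarrow> 0"
proof -
  obtain G :: "nat \<Rightarrow> nat \<Rightarrow> nat \<Rightarrow> 'a \<Rightarrow> real" where "\<forall>J k. \<forall>j<J. G J j k \<in> dual_ball \<and> G J j k (x j) \<ge> c/2"
    and Bessel: "\<forall>J k z. (\<Sum>j<J. (G J j k z)\<^sup>2) \<le> (norm z)\<^sup>2"
    using merging_tree_Bessel[OF H0 H gap] .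
  then have G: "G J j k \<in> dual_ball" "G J j k (x j) \<ge> c/2" if "j < J" for J j k
    using that by blast+
  \<comment> \<open>Indexing by pairs makes one filter serve all levels and points. The default 0
    for \<open>j \<ge> J\<close> eventually disappears along it.\<close>
  define Pt where "Pt J = (\<lambda>(j, z). if j < J then G J j 0 z else 0)" for J
  have "\<bar>Pt J i\<bar> \<le> norm (snd i)" for J i
    using dual_ball_abs_le[OF G(1)] by (auto simp: Pt_def split: prod.splits)
  then obtain F g where F: "F \<noteq> bot" "F \<le> sequentially" and lim: "\<forall>i. ((\<lambda>J. Pt J i) \<longlongrightarrow> g i) F"
    by (rule pointwise_cluster_filter[where B = "\<lambda>i. norm (snd i)"])
  have ev: "eventually (\<lambda>J. j < J) F" for j
    using filter_leD[OF F(2) eventually_gt_at_top] .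
  have lim': "((\<lambda>J. G J j 0 z) \<longlongrightarrow> g (j, z)) F" for j z
    by (rule Lim_transform_eventually[OF lim[rule_format, of "(j, z)"]])
      (use ev[of j] in eventually_elim, simp add: Pt_def)
  have "(\<lambda>z. g (j, z)) \<in> dual_ball" for j
  proof -
    have "g (j, y + z) = g (j, y) + g (j, z)" for y z
    proof (rule tendsto_unique[OF F(1) lim'])
      show "((\<lambda>J. G J j 0 (y + z)) \<longlongrightarrow> g (j, y) + g (j, z)) F"
        by (rule Lim_transform_eventually[OF tendsto_add[OF lim'[of j y] lim'[of j z]]])
          (use ev[of j] in eventually_elim, simp add: linear_add[OF dual_ball_linear[OF G(1)]])
    qed
    moreover have "g (j, r *\<^sub>R z) = r * g (j, z)" for r z
    proof (rule tendsto_unique[OF F(1) lim'])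
      show "((\<lambda>J. G J j 0 (r *\<^sub>R z)) \<longlongrightarrow> r * g (j, z)) F"
        by (rule Lim_transform_eventually[OF tendsto_mult_left[OF lim'[of j z]]])
          (use ev[of j] in eventually_elim, simp add: linear_scale[OF dual_ball_linear[OF G(1)]])
    qed
    moreover have "\<bar>g (j, z)\<bar> \<le> norm z" for z
      by (rule tendsto_upperbound[OF tendsto_rabs[OF lim'[of j z]] _ F(1)])
        (use ev[of j] in eventually_elim, auto dest: dual_ball_abs_le[OF G(1)])
    ultimately show ?thesis by (auto simp: dual_ball_def intro!: linearI)
  qed
  moreover have "g (j, x j) \<ge> c/2" for j
    by (rule tendsto_lowerbound[OF lim'[of j "x j"] _ F(1)])
      (use ev[of j] in eventually_elim, rule G(2))
  moreover have "(\<lambda>j. g (j, z)) \<longlonglongrightarrow> 0" for z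
  proof -
    have "(\<Sum>j<L. (g (j, z))\<^sup>2) \<le> (norm z)\<^sup>2" for L
    proof (rule tendsto_upperbound[OF _ _ F(1)])
      show "((\<lambda>J. \<Sum>j<L. (G J j 0 z)\<^sup>2) \<longlongrightarrow> (\<Sum>j<L. (g (j, z))\<^sup>2)) F"
        by (intro tendsto_intros lim')
      show "eventually (\<lambda>J. (\<Sum>j<L. (G J j 0 z)\<^sup>2) \<le> (norm z)\<^sup>2) F"
        using ev[of L]
      proof eventually_elim
        case (elim J)
        have "(\<Sum>j<L. (G J j 0 z)\<^sup>2) \<le> (\<Sum>j<J. (G J j 0 z)\<^sup>2)"
          using elim by (intro sum_mono2) auto
        then show ?case using Bessel by (meson order_trans)
      qed
    qed
    then have "summable (\<lambda>j. (g (j, z))\<^sup>2)"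
      by (intro bounded_imp_summable[where B = "(norm z)\<^sup>2"]) (simp_all del: sum.lessThan_Suc flip: lessThan_Suc_atMost)
    then have "(\<lambda>j. (g (j, z))\<^sup>2) \<longlonglongrightarrow> 0" by (rule summable_LIMSEQ_zero)
    then show ?thesis by simp
  qed
  ultimately show ?thesis by (intro that[of "\<lambda>j z. g (j, z)"]) auto
qed

theorem Josefson_Nissenzweig:
  assumes inf: "\<nexists>B :: 'a::real_normed_vector set. finite B \<and> span B = UNIV"
  obtains \<psi> :: "nat \<Rightarrow> 'a::real_normed_vector \<Rightarrow> real" and \<delta> where
    "\<forall>m. \<psi> m \<in> dual_ball" "\<forall>x. (\<lambda>m. \<psi> m x) \<longlonglongrightarrow> 0"
    "\<delta> > 0" "\<forall>m. \<exists>x. norm x \<le> 1 \<and> \<bar>\<psi> m x\<bar> \<ge> \<delta>"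
proof -
  obtain f :: "nat \<Rightarrow> 'a \<Rightarrow> real" and M where
    "\<forall>n. f n \<in> dual_ball \<and> (\<exists>x. norm x \<le> 1 \<and> \<bar>f n x\<bar> \<ge> 1/2) \<and> f n \<in> M"
    "\<forall>u\<in>M. \<forall>v\<in>M. (\<lambda>x. (u x + v x) / 2) \<in> M"
    "\<forall>g\<in>M. \<exists>y m. half_normed_at g y \<and> (\<forall>n\<ge>m. f n y = 0)"
    using annihilating_sequence[OF inf] .
  then have f: "f n \<in> dual_ball" "\<exists>x. norm x \<le> 1 \<and> \<bar>f n x\<bar> \<ge> 1/2" "f n \<in> M"
    and M: "u \<in> M \<Longrightarrow> v \<in> M \<Longrightarrow> (\<lambda>x. (u x + v x) / 2) \<in> M"
    "g \<in> M \<Longrightarrow> \<exists>y m. half_normed_at g y \<and> (\<forall>n\<ge>m. f n y = 0)" for n u v g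
    by blast+
  show ?thesis
  proof (cases "\<forall>x. (\<lambda>n. f n x) \<longlonglongrightarrow> 0")
    case True
    then show ?thesis using f(1,2) by (intro that[of f "1/2"]) auto
  next
    case False
    then obtain z0 where z0: "\<not> (\<lambda>n. f n z0) \<longlonglongrightarrow> 0" by blast
    \<comment> \<open>Failure of convergence at \<open>z0\<close> gives infinitely many values of
      modulus at least some \<open>e\<close>; a sign change makes infinitely many of them positive,
      and rescaling moves the point into the unit ball.\<close>
    have "\<exists>z c. norm z \<le> 1 \<and> c > 0 \<and> infinite {n. f n z \<ge> c}"
    proof -
      have "z0 \<noteq> 0" using z0 linear_0[OF dual_ball_linear[OF f(1)]] by auto
      obtain e where e: "e > 0" "infinite {n. \<bar>f n z0\<bar> \<ge> e}"
        using z0 unfolding LIMSEQ_iff by (auto simp: infinite_nat_iff_unbounded_le not_less)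
      have "{n. \<bar>f n z0\<bar> \<ge> e} = {n. f n z0 \<ge> e} \<union> {n. f n (- z0) \<ge> e}"
        using linear_neg[OF dual_ball_linear[OF f(1)]] by (auto simp: abs_if)
      then obtain z1 where z1: "infinite {n. f n z1 \<ge> e}" "norm z1 = norm z0"
        using e(2) by (metis finite_Un norm_minus_cancel)
      have "{n. f n z1 \<ge> e} = {n. f n (z1 /\<^sub>R norm z0) \<ge> e / norm z0}"
        using \<open>z0 \<noteq> 0\<close> linear_scale[OF dual_ball_linear[OF f(1)]]
        by (auto simp: field_simps)
      then show ?thesis using z1 e(1) \<open>z0 \<noteq> 0\<close>
        by (intro exI[of _ "z1 /\<^sub>R norm z0"] exI[of _ "e / norm z0"]) auto
    qed
    then obtain z c where z: "norm z \<le> 1" "c > 0" "infinite {n. f n z \<ge> c}" by blast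
    obtain s :: "nat \<Rightarrow> nat" where s: "strict_mono s" "\<And>k. f (s k) z \<ge> c"
      using infinite_enumerate[OF z(3)] by auto
    define F where "F = f \<circ> s"
    have F: "F k \<in> dual_ball" "F k \<in> M" "F k z \<ge> c" for k
      using f s by (auto simp: F_def)
    have tail: "\<exists>y m. half_normed_at g y \<and> (\<forall>k\<ge>m. F k y = 0)" if g: "g \<in> M" for g
    proof -
      obtain y m where "half_normed_at g y" "\<forall>n\<ge>m. f n y = 0" using M(2)[OF g] by blast
      then have "half_normed_at g y \<and> (\<forall>k\<ge>m. F k y = 0)"
        using order_trans[OF _ strict_mono_imp_increasing[OF s(1)]] by (auto simp: F_def)
      then show ?thesis by blast
    qed
    have hull: "H k \<in> midpoint_hull (F ` {k..})" if "merges\<^sup>*\<^sup>* F H" for H k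
      using merges_midpoint_hull[OF that] .
    \<comment> \<open>Midpoints preserve the lower bound \<open>c\<close> at \<open>z\<close>, so no
      combination becomes small in norm.\<close>
    have hullM: "g \<in> M" "g \<in> dual_ball" "g z \<ge> c" if "g \<in> midpoint_hull (F ` A)" for g A
    proof -
      show "g \<in> M" "g \<in> dual_ball"
        by (rule midpoint_hull_minimal[OF that]; use F(1,2) M(1) dual_ball_midpoint in blast)+
      have "c \<le> F k z \<and> F k z \<le> 1" for k
        using F(3)[of k] dual_ball_abs_le[OF F(1), of k z] z(1) by simp
      then show "g z \<ge> c" using midpoint_hull_bounds[OF that, of c z 1] by blast
    qed
    \<comment> \<open>Either from some \<open>H0\<close> on no merging removes an oscillation
      \<open>d\<close>, which yields an infinite merging tree, or every merged sequence can be
      merged further until it no longer oscillates by a given amount.\<close>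
    show ?thesis
    proof (cases "\<exists>d>0. \<exists>H. merges\<^sup>*\<^sup>* F H \<and> (\<forall>H'. merges\<^sup>*\<^sup>* H H' \<longrightarrow> oscillates d H')")
      case True
      then obtain d H0 where d: "d > 0" "merges\<^sup>*\<^sup>* F H0" "\<And>H'. merges\<^sup>*\<^sup>* H0 H' \<Longrightarrow> oscillates d H'"
        by blast
      define R where "R H H' \<longleftrightarrow> (\<exists>a b x. norm x \<le> 1 \<and> (\<forall>k z. H' k z = (H (a k) z + H (b k) z) / 2) \<and>
        (\<forall>k. H (a k) x - H (b k) x \<ge> d))" for H H' :: "nat \<Rightarrow> 'a \<Rightarrow> real"
      have "\<exists>H'. merges\<^sup>*\<^sup>* H0 H' \<and> R H H'" if H: "merges\<^sup>*\<^sup>* H0 H" for H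
      proof -
        obtain x a b where xab: "norm x \<le> 1" "strict_mono a" "strict_mono b"
            "\<forall>k::nat. H (a k) x - H (b k) x \<ge> d"
          using d(3)[OF H] unfolding oscillates_def by blast
        define H' where "H' = (\<lambda>k x. (H (a k) x + H (b k) x) / 2)"
        have "merges H H'" using xab by (auto simp: merges_def H'_def)
        then have "merges\<^sup>*\<^sup>* H0 H'" by (rule rtranclp.rtrancl_into_rtrancl[OF H])
        moreover have "R H H'" using xab unfolding R_def H'_def by blast
        ultimately show ?thesis by blast
      qed
      then have "\<exists>T. \<forall>n. (merges\<^sup>*\<^sup>* H0 (T n) \<and> (n = 0 \<longrightarrow> T n = H0)) \<and> R (T n) (T (Suc n))"
        by (intro dependent_nat_choice) auto
      then obtain T where T: "T 0 = H0" "\<And>n. R (T n) (T (Suc n))" by blast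
      from T(2) obtain a b x where x: "\<And>n. norm (x n) \<le> 1"
        and step: "\<And>n k z. T (Suc n) k z = (T n (a n k) z + T n (b n k) z) / 2"
        and gap: "\<And>n k. T n (a n k) (x n) - T n (b n k) (x n) \<ge> d"
        unfolding R_def by metis
      have T0: "T 0 k \<in> dual_ball" for k using hullM(2)[OF hull[OF d(2)]] T(1) by simp
      obtain g where g: "\<forall>j. g j \<in> dual_ball \<and> g j (x j) \<ge> d/2" "\<forall>z. (\<lambda>j. g j z) \<longlonglongrightarrow> 0"
        using merging_tree_weak_star_null[of T a b d x, OF T0 step gap] .
      have "\<exists>y. norm y \<le> 1 \<and> \<bar>g j y\<bar> \<ge> d/2" for j
        using x[of j] g(1)[rule_format, of j] by (intro exI[of _ "x j"]) auto
      then show ?thesis using g d(1) by (intro that[of g "d/2"]) auto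
    next
      case False
      then have stab: "\<exists>H'. merges\<^sup>*\<^sup>* H H' \<and> \<not> oscillates d H'" if "d > 0" "merges\<^sup>*\<^sup>* F H" for d H
        using that by blast
      \<comment> \<open>The bound \<open>1 / Suc n\<close> on the oscillation tends to 0, while each
        sequence is merged from all earlier ones and so remains under their control.\<close>
      have "\<exists>T. \<forall>n. (merges\<^sup>*\<^sup>* F (T n) \<and> \<not> oscillates (1 / Suc n) (T n)) \<and> merges\<^sup>*\<^sup>* (T n) (T (Suc n))"
      proof (rule dependent_nat_choice)
        show "\<exists>H. merges\<^sup>*\<^sup>* F H \<and> \<not> oscillates (1 / Suc 0) H" using stab[of 1 F] by auto
        show "\<exists>H'. (merges\<^sup>*\<^sup>* F H' \<and> \<not> oscillates (1 / Suc (Suc n)) H') \<and> merges\<^sup>*\<^sup>* H H'"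
          if "merges\<^sup>*\<^sup>* F H \<and> \<not> oscillates (1 / Suc n) H" for H n
          using stab[of "1 / Suc (Suc n)" H] that by (auto intro: rtranclp_trans)
      qed
      then obtain T where T: "\<And>n. merges\<^sup>*\<^sup>* F (T n)" "\<And>n. \<not> oscillates (1 / Suc n) (T n)"
        "\<And>n. merges\<^sup>*\<^sup>* (T n) (T (Suc n))" by blast
      have nest: "merges\<^sup>*\<^sup>* (T m) (T n)" if "m \<le> n" for m n
        using that by (induction rule: dec_induct) (auto intro: rtranclp_trans T(3))
      \<comment> \<open>The diagonal: for \<open>n \<ge> m\<close> the functional \<open>D n\<close>
        lies in the midpoint hull of the terms of \<open>T m\<close> from \<open>n\<close> on, so
        its values oscillate as little as those of \<open>T m\<close>.\<close>
      define D where "D n = T n n" for n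
      have Dhull: "D n \<in> midpoint_hull (F ` {n..})" for n
        unfolding D_def by (rule hull[OF T(1)])
      have Cauchy: "Cauchy (\<lambda>n. D n x)" if x: "norm x \<le> 1" for x
      proof (rule metric_CauchyI)
        fix e :: real assume "e > 0"
        then have "e / 2 > 0" by simp
        then obtain m where "inverse (Suc m) < e / 2" using reals_Archimedean by blast
        then have m: "1 / Suc m < e / 2" by (simp add: inverse_eq_divide)
        obtain N where N: "\<forall>p\<ge>N. \<forall>q\<ge>N. T m p x - T m q x < 1 / Suc m"
          using not_oscillates[OF T(2) x] .
        have near: "\<bar>D n x - T m N x\<bar> \<le> 1 / Suc m" if n: "n \<ge> max m N" for n
        proof -
          have "D n \<in> midpoint_hull (T m ` {n..})"
            unfolding D_def using n by (intro merges_midpoint_hull nest) auto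
          then have "T m N x - 1 / Suc m \<le> D n x \<and> D n x \<le> T m N x + 1 / Suc m"
          proof (rule midpoint_hull_bounds)
            fix g assume "g \<in> T m ` {n..}"
            then obtain p where "g = T m p" "p \<ge> N" using n by auto
            then show "T m N x - 1 / Suc m \<le> g x \<and> g x \<le> T m N x + 1 / Suc m"
              using N by (smt (verit) order_refl)
          qed
          then show ?thesis by (simp add: abs_le_iff)
        qed
        show "\<exists>K. \<forall>p\<ge>K. \<forall>q\<ge>K. dist (D p x) (D q x) < e"
        proof (intro exI[of _ "max m N"] allI impI)
          fix p q assume "p \<ge> max m N" "q \<ge> max m N"
          then show "dist (D p x) (D q x) < e"
            using near[of p] near[of q] m by (simp add: dist_real_def)
        qed
      qed
      \<comment> \<open>Late combinations vanish at the point \<open>y\<close> that half-norms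
        \<open>D n\<close>, and \<open>\<bar>D n y\<bar> \<ge> c / 2\<close> since
        \<open>D n z \<ge> c\<close>; halving the difference leaves \<open>c / 4\<close>.\<close>
      have "\<exists>k\<ge>n. \<exists>y. norm y \<le> 1 \<and> \<bar>(D n y - D k y) / 2\<bar> \<ge> c / 4" for n
      proof -
        obtain y m where y: "half_normed_at (D n) y" "\<And>k. k \<ge> m \<Longrightarrow> F k y = 0"
          using tail[OF hullM(1)[OF Dhull]] by blast
        have "\<bar>D n z\<bar> \<le> 2 * \<bar>D n y\<bar>" "norm y \<le> 1" using y(1) z(1) by (auto simp: half_normed_at_def)
        moreover have "D n z \<ge> c" by (rule hullM(3)[OF Dhull])
        moreover have "0 \<le> D (max n m) y \<and> D (max n m) y \<le> 0"
          by (rule midpoint_hull_bounds[OF Dhull]) (auto simp: y(2))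
        ultimately show ?thesis
          by (intro exI[of _ "max n m"] conjI exI[of _ y]) auto
      qed
      then obtain k where k: "\<And>n. k n \<ge> n"
        "\<And>n. \<exists>y. norm y \<le> 1 \<and> \<bar>(D n y - D (k n) y) / 2\<bar> \<ge> c / 4" by metis
      have klim: "filterlim k at_top sequentially"
        using k(1) by (intro filterlim_at_top_mono[OF filterlim_ident]) auto
      have ball: "(\<lambda>n. (D n x - D (k n) x) / 2) \<longlonglongrightarrow> 0" if x: "norm x \<le> 1" for x
      proof -
        obtain l where l: "(\<lambda>n. D n x) \<longlonglongrightarrow> l"
          using Cauchy[OF x] by (auto simp: Cauchy_convergent_iff convergent_def)
        have "(\<lambda>n. D (k n) x) \<longlonglongrightarrow> l" using filterlim_compose[OF l klim] .
        from tendsto_divide[OF tendsto_diff[OF l this] tendsto_const[of 2]] show ?thesis by simp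
      qed
      have "(\<lambda>n. (D n x - D (k n) x) / 2) \<longlonglongrightarrow> 0" for x
      proof (cases "x = 0")
        case False
        have lin: "linear (D n)" for n using hullM(2)[OF Dhull] by (rule dual_ball_linear)
        have "(\<lambda>n. norm x * ((D n (x /\<^sub>R norm x) - D (k n) (x /\<^sub>R norm x)) / 2)) \<longlonglongrightarrow> norm x * 0"
          using False by (intro tendsto_mult_left ball) simp
        moreover have "norm x * ((D n (x /\<^sub>R norm x) - D (k n) (x /\<^sub>R norm x)) / 2) =
            (D n x - D (k n) x) / 2" for n
          using False by (simp add: linear_scale[OF lin] field_simps)
        ultimately show ?thesis by simp
      qed (use ball[of 0] in simp)
      then show ?thesis
        using k(2) z(2) hullM(2)[OF Dhull]
        by (intro that[of "\<lambda>n x. (D n x - D (k n) x) / 2" "c/4"]) (auto intro!: dual_ball_half_diff)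
    qed
  qed
qed

section \<open>Weak-star convergence of symmetric forms\<close>

lemma sum_lessThan_add: "(\<Sum>k<p + q. g k) = (\<Sum>k<p. g k) + (\<Sum>k<q. g (p + k))"
  for g :: "nat \<Rightarrow> 'b::comm_monoid_add"
  by (induction q) (simp_all add: add.assoc)

lemma algebraic_tensors_diff:
  assumes "u \<in> algebraic_tensors smul n" "v \<in> algebraic_tensors smul n"
  shows "(\<lambda>B. u B - v B) \<in> algebraic_tensors smul n"
proof -
  obtain p c x q d y where u: "u = tensor_sum smul n p c x" and v: "v = tensor_sum smul n q d y"
    using assms by (auto simp: algebraic_tensors_def)
  have "(\<lambda>B. u B - v B) = tensor_sum smul n (p + q) (\<lambda>k. if k < p then c k else - d (k - p))
      (\<lambda>k. if k < p then x k else y (k - p))"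
    by (auto simp: u v tensor_sum_def fun_eq_iff sum_lessThan_add sum_negf)
  then show ?thesis by (auto simp: algebraic_tensors_def)
qed

text \<open>The easy half of the duality: the strict bound on the infimum provides a representation
  of cost below \<open>e\<close>, which is then estimated termwise.\<close>

lemma algebraic_tensor_norm_le:
  assumes u: "u \<in> algebraic_tensors smul n" "projective_norm smul n u < e"
    and B: "B \<in> multilinear_forms smul n" "\<And>x. norm (B x) \<le> C * (\<Prod>i<n. norm (x i))"
    and C: "C \<ge> 0"
  shows "norm (u B) \<le> C * e"
proof -
  define R where "R = {\<Sum>k<p. norm (c k) * (\<Prod>i<n. norm (x k i)) | p c x. u = tensor_sum smul n p c x}"
  have "R \<noteq> {}" using u(1) by (auto simp: R_def algebraic_tensors_def)
  moreover have "Inf R < e" using u(2) by (simp add: R_def projective_norm_def)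
  ultimately obtain r where "r \<in> R" "r < e" by (rule cInf_lessD[THEN bexE])
  then obtain p c x where cx: "u = tensor_sum smul n p c x"
    "(\<Sum>k<p. norm (c k) * (\<Prod>i<n. norm (x k i))) < e"
    by (auto simp: R_def)
  have "norm (u B) \<le> (\<Sum>k<p. norm (c k * B (x k)))"
    using B(1) by (simp add: cx(1) tensor_sum_def norm_sum)
  also have "\<dots> \<le> (\<Sum>k<p. norm (c k) * (C * (\<Prod>i<n. norm (x k i))))"
    by (intro sum_mono) (simp add: norm_mult mult_left_mono B(2))
  also have "\<dots> = C * (\<Sum>k<p. norm (c k) * (\<Prod>i<n. norm (x k i)))"
    by (simp add: sum_distrib_left algebra_simps)
  also have "\<dots> \<le> C * e" using cx(2) C by (intro mult_left_mono) auto
  finally show ?thesis .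
qed

lemma symmetrize_symmetric_form:
  assumes "A \<in> symmetric_forms smul n"
  shows "symmetrize_form n A = A"
proof
  fix x
  have "(\<Sum>\<sigma> | \<sigma> permutes {..<n}. A (x \<circ> \<sigma>)) = (\<Sum>\<sigma> | \<sigma> permutes {..<n}. A x)"
    using assms by (intro sum.cong) (auto simp: symmetric_forms_def)
  also have "\<dots> = fact n * A x" by (simp add: card_permutations)
  finally show "symmetrize_form n A x = A x" by (simp add: symmetrize_form_def)
qed

text \<open>Pointwise convergence settles algebraic tensors, which are finite sums. An element of
  the completion is approximated by one of these uniformly over all symmetric forms bounded by
  \<open>C\<close>.\<close>

lemma weak_star_tendsto_bounded:
  assumes F: "\<And>m. F m \<in> symmetric_forms smul n" and A: "A \<in> symmetric_forms smul n"
    and bF: "\<And>m x. norm (F m x) \<le> C * (\<Prod>i<n. norm (x i))"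
    and bA: "\<And>x. norm (A x) \<le> C * (\<Prod>i<n. norm (x i))"
    and C: "C \<ge> 0" and lim: "\<And>x. (\<lambda>m. F m x) \<longlonglongrightarrow> A x"
  shows "weak_star_tendsto smul n F A"
  unfolding weak_star_tendsto_def
proof
  fix \<phi> assume "\<phi> \<in> symmetric_tensors smul n"
  then obtain \<psi> where \<psi>: "\<psi> \<in> completed_tensors smul n" and \<phi>: "\<phi> = symmetrization smul n \<psi>"
    by (auto simp: symmetric_tensors_def)
  have cont: "B \<in> continuous_forms smul n" if "B \<in> symmetric_forms smul n" for B
    using that by (simp add: symmetric_forms_def)
  then have mult: "B \<in> multilinear_forms smul n" if "B \<in> symmetric_forms smul n" for B
    using that by (auto simp: continuous_forms_def)
  \<comment> \<open>Symmetrization fixes symmetric forms, so the pairing can be computed before the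
    projection is applied.\<close>
  have \<phi>\<psi>: "\<phi> B = \<psi> B" if "B \<in> symmetric_forms smul n" for B
    using cont[OF that] symmetrize_symmetric_form[OF that] by (simp add: \<phi> symmetrization_def)
  obtain u where "\<forall>k. u k \<in> algebraic_tensors smul n"
    "\<forall>e>0. \<exists>N. \<forall>k\<ge>N. \<forall>l\<ge>N. projective_norm smul n (\<lambda>B. u k B - u l B) < e"
    "\<forall>B\<in>continuous_forms smul n. (\<lambda>k. u k B) \<longlonglongrightarrow> \<psi> B"
    using \<psi> unfolding completed_tensors_def by blast
  then have u: "\<And>k. u k \<in> algebraic_tensors smul n"
    "\<And>e. e > 0 \<Longrightarrow> \<exists>N. \<forall>k\<ge>N. \<forall>l\<ge>N. projective_norm smul n (\<lambda>B. u k B - u l B) < e"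
    "\<And>B. B \<in> continuous_forms smul n \<Longrightarrow> (\<lambda>k. u k B) \<longlonglongrightarrow> \<psi> B"
    by blast+
  have "(\<lambda>m. \<psi> (F m)) \<longlonglongrightarrow> \<psi> A"
  proof (rule tendstoI)
    fix e :: real assume e: "e > 0"
    \<comment> \<open>\<open>C + 1\<close> keeps the quotient defined for \<open>C = 0\<close> and
      makes \<open>C * e'\<close> smaller than \<open>e / 3\<close>.\<close>
    define e' where "e' = e / (3 * (C + 1))"
    have e': "e' > 0" using e C by (simp add: e'_def)
    have "C * e' < e / 3" using e C by (simp add: e'_def field_simps)
    obtain N where N: "\<And>l. l \<ge> N \<Longrightarrow> projective_norm smul n (\<lambda>B. u N B - u l B) < e'"
      using u(2)[OF e'] by blast
    \<comment> \<open>The Cauchy estimate between \<open>u N\<close> and \<open>u l\<close> survives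
      the limit in \<open>l\<close>.\<close>
    have near: "norm (u N B - \<psi> B) \<le> C * e'"
      if B: "B \<in> symmetric_forms smul n" "\<And>x. norm (B x) \<le> C * (\<Prod>i<n. norm (x i))" for B
    proof (rule tendsto_upperbound)
      show "(\<lambda>l. norm (u N B - u l B)) \<longlonglongrightarrow> norm (u N B - \<psi> B)"
        by (intro tendsto_intros u(3) cont B)
      show "eventually (\<lambda>l. norm (u N B - u l B) \<le> C * e') sequentially"
        using eventually_ge_at_top[of N]
      proof eventually_elim
        case (elim l)
        show ?case
          by (rule algebraic_tensor_norm_le[OF algebraic_tensors_diff[OF u(1) u(1)] N[OF elim] mult[OF B(1)] B(2) C])
      qed
    qed simp
    obtain p c x where ux: "u N = tensor_sum smul n p c x"
      using u(1)[of N] by (auto simp: algebraic_tensors_def)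
    have uB: "u N B = (\<Sum>k<p. c k * B (x k))" if "B \<in> symmetric_forms smul n" for B
      using mult[OF that] by (simp add: ux tensor_sum_def)
    have "(\<lambda>m. u N (F m)) \<longlonglongrightarrow> u N A"
      unfolding uB[OF F] uB[OF A] by (intro tendsto_intros lim)
    then have "eventually (\<lambda>m. dist (u N (F m)) (u N A) < e / 3) sequentially"
      by (rule tendstoD) (use e in simp)
    then show "eventually (\<lambda>m. dist (\<psi> (F m)) (\<psi> A) < e) sequentially"
    proof eventually_elim
      case (elim m)
      have "dist (\<psi> (F m)) (\<psi> A) \<le>
          dist (u N (F m)) (\<psi> (F m)) + dist (u N (F m)) (u N A) + dist (u N A) (\<psi> A)"
        by metric
      then show ?case
        using elim near[OF F[of m] bF] near[OF A bA] \<open>C * e' < e / 3\<close>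
        by (simp add: dist_norm)
    qed
  qed
  then show "(\<lambda>m. \<phi> (F m)) \<longlonglongrightarrow> \<phi> A" using \<phi>\<psi>[OF F] \<phi>\<psi>[OF A] by simp
qed

section \<open>Symmetric forms built from functionals\<close>

lemma symmetric_forms_add:
  assumes "A \<in> symmetric_forms smul n" "B \<in> symmetric_forms smul n"
  shows "(\<lambda>x. A x + B x) \<in> symmetric_forms smul n"
proof -
  have "(\<lambda>x. A x + B x) \<in> multilinear_forms smul n"
    using assms unfolding symmetric_forms_def continuous_forms_def multilinear_forms_def
    by (auto simp: Vector_Spaces.linear_iff algebra_simps) metis
  moreover have "continuous_on UNIV (\<lambda>x. A x + B x)"
    using assms by (auto simp: symmetric_forms_def continuous_forms_def intro!: continuous_intros)
  ultimately show ?thesis using assms by (auto simp: symmetric_forms_def continuous_forms_def)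
qed

lemma symmetric_forms_mult:
  assumes "A \<in> symmetric_forms smul n"
  shows "(\<lambda>x. c * A x) \<in> symmetric_forms smul n"
proof -
  have "(\<lambda>x. c * A x) \<in> multilinear_forms smul n"
    using assms unfolding symmetric_forms_def continuous_forms_def multilinear_forms_def
    by (auto simp: Vector_Spaces.linear_iff algebra_simps)
  moreover have "continuous_on UNIV (\<lambda>x. c * A x)"
    using assms by (auto simp: symmetric_forms_def continuous_forms_def intro!: continuous_intros)
  ultimately show ?thesis using assms by (auto simp: symmetric_forms_def continuous_forms_def)
qed

text \<open>The bound \<open>C\<close> makes the values bounded above, without which the real
  supremum would say nothing about them.\<close>

lemma form_norm_upper:
  assumes "\<And>x. (\<forall>i<n. norm (x i) \<le> 1) \<Longrightarrow> norm (A x) \<le> C" "\<forall>i<n. norm (x i) \<le> 1"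
  shows "norm (A x) \<le> form_norm n A"
  unfolding form_norm_def using assms by (intro cSUP_upper bdd_aboveI2[where M = C]) auto

lemma form_norm_least:
  assumes "\<And>x. (\<forall>i<n. norm (x i) \<le> 1) \<Longrightarrow> norm (A x) \<le> C"
  shows "form_norm n A \<le> C"
  unfolding form_norm_def using assms by (intro cSUP_least) (auto intro: exI[of _ "\<lambda>_. 0"])

context normed_space_over
begin

abbreviation functional :: "('x \<Rightarrow> 'k) \<Rightarrow> bool" where
  "functional f \<equiv> Vector_Spaces.linear smul (*) f"

lemma functional_iff: "functional f \<longleftrightarrow> (\<forall>x y. f (x + y) = f x + f y) \<and> (\<forall>c x. f (smul c x) = c * f x)"
proof -
  have "vector_space smul" by unfold_locales
  moreover have "vector_space ((*) :: 'k \<Rightarrow> _)" by unfold_locales (simp_all add: algebra_simps)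
  ultimately show ?thesis by (simp add: Vector_Spaces.linear_iff)
qed

lemma continuous_functional:
  assumes f: "functional f" "\<And>x. norm (f x) \<le> norm x"
  shows "continuous_on UNIV f"
proof -
  have "bounded_linear f"
  proof (rule bounded_linear_intro[where K = 1])
    fix r x
    have "f (r *\<^sub>R x) = f (smul (of_real r) x)" by (simp add: smul_of_real)
    then show "f (r *\<^sub>R x) = r *\<^sub>R f x" using f(1) by (simp add: functional_iff scaleR_conv_of_real)
  qed (use f in \<open>simp_all add: functional_iff\<close>)
  then show ?thesis by (rule linear_continuous_on)
qed

lemma prod_continuous_form:
  assumes g: "\<And>i. i < n \<Longrightarrow> functional (g i)" "\<And>i x. i < n \<Longrightarrow> norm (g i x) \<le> norm x"
  shows "(\<lambda>x. \<Prod>i<n. g i (x i)) \<in> continuous_forms smul n"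
proof -
  have "functional (\<lambda>t. \<Prod>j<n. g j ((x(i := t)) j))" if "i < n" for i x
  proof -
    have "(\<Prod>j<n. g j ((x(i := t)) j)) = g i t * (\<Prod>j\<in>{..<n} - {i}. g j (x j))" for t
      using that by (subst prod.remove[of _ i]) (auto intro!: prod.cong)
    then show ?thesis using g(1)[OF that] by (simp add: functional_iff algebra_simps)
  qed
  moreover have "(\<Prod>i<n. g i (x i)) = (\<Prod>i<n. g i (y i))" if "\<forall>i<n. x i = y i" for x y
    using that by (intro prod.cong) auto
  ultimately have "(\<lambda>x. \<Prod>i<n. g i (x i)) \<in> multilinear_forms smul n"
    unfolding multilinear_forms_def by blast
  moreover have "continuous_on UNIV (\<lambda>x. \<Prod>i<n. g i (x i))"
  proof (rule continuous_on_prod)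
    fix i assume "i \<in> {..<n}"
    then have "continuous_on UNIV (g i)" using g by (intro continuous_functional) auto
    then show "continuous_on UNIV (\<lambda>x. g i (x i))"
      by (rule continuous_on_compose2) auto
  qed
  ultimately show ?thesis by (simp add: continuous_forms_def)
qed

lemma power_symmetric_form:
  assumes "functional f" "\<And>x. norm (f x) \<le> norm x"
  shows "(\<lambda>x. \<Prod>i<n. f (x i)) \<in> symmetric_forms smul n"
proof -
  have "(\<Prod>i<n. f ((x \<circ> \<sigma>) i)) = (\<Prod>i<n. f (x i))" if "\<sigma> permutes {..<n}" for \<sigma> x
    using prod.permute[OF that, of "\<lambda>i. f (x i)"] by (simp add: comp_def)
  then show ?thesis using prod_continuous_form[of n "\<lambda>_. f"] assms by (simp add: symmetric_forms_def)
qed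

text \<open>This is \<open>n\<close> times the symmetrization of the product of one \<open>f\<close>
  and \<open>n - 1\<close> copies of \<open>h\<close>: the sum runs over the position of
  \<open>f\<close>.\<close>

definition mixed_form :: "nat \<Rightarrow> ('x \<Rightarrow> 'k) \<Rightarrow> ('x \<Rightarrow> 'k) \<Rightarrow> ('x, 'k) form" where
  "mixed_form n h f x = (\<Sum>i<n. \<Prod>j<n. if j = i then f (x j) else h (x j))"

lemma mixed_form_symmetric:
  assumes f: "functional f" "\<And>x. norm (f x) \<le> norm x" and h: "functional h" "\<And>x. norm (h x) \<le> norm x"
  shows "mixed_form n h f \<in> symmetric_forms smul n"
proof -
  have summand: "(\<lambda>x. \<Prod>j<n. if j = i then f (x j) else h (x j)) \<in> continuous_forms smul n" for i
    using prod_continuous_form[of n "\<lambda>j. if j = i then f else h"] assms by (simp add: if_distribR)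
  have "mixed_form n h f \<in> multilinear_forms smul n"
    unfolding multilinear_forms_def
  proof (intro CollectI conjI allI impI)
    fix x y :: "nat \<Rightarrow> 'x" assume "\<forall>i<n. x i = y i"
    then show "mixed_form n h f x = mixed_form n h f y"
      unfolding mixed_form_def by (intro sum.cong prod.cong) auto
  next
    fix i x assume "i < n"
    then have "functional (\<lambda>t. \<Prod>j<n. if j = k then f ((x(i := t)) j) else h ((x(i := t)) j))" for k
      using summand[of k] unfolding continuous_forms_def multilinear_forms_def by blast
    then show "functional (\<lambda>t. mixed_form n h f (x(i := t)))"
      unfolding mixed_form_def functional_iff by (simp add: sum.distrib sum_distrib_left)
  qed
  moreover have "continuous_on UNIV (mixed_form n h f)"
    unfolding mixed_form_def using summand by (intro continuous_on_sum) (simp add: continuous_forms_def)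
  moreover have "mixed_form n h f (x \<circ> \<sigma>) = mixed_form n h f x" if \<sigma>: "\<sigma> permutes {..<n}" for \<sigma> x
  proof -
    \<comment> \<open>Permuting the arguments moves the position \<open>i\<close> of
      \<open>f\<close> to \<open>\<sigma> i\<close>, which only reorders the summands.\<close>
    have reindex: "(\<Prod>j<n. if j = i then f ((x \<circ> \<sigma>) j) else h ((x \<circ> \<sigma>) j)) =
        (\<Prod>j<n. if j = \<sigma> i then f (x j) else h (x j))" for i
    proof -
      have "\<sigma> j = \<sigma> i \<longleftrightarrow> j = i" for j using permutes_inj[OF \<sigma>] by (auto dest: injD)
      then show ?thesis
        using prod.permute[OF \<sigma>, of "\<lambda>j. if j = \<sigma> i then f (x j) else h (x j)"]
        by (simp add: comp_def cong: if_cong)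
    qed
    show ?thesis
      unfolding mixed_form_def reindex
      using sum.permute[OF \<sigma>, of "\<lambda>i. \<Prod>j<n. if j = i then f (x j) else h (x j)"]
      by (simp add: comp_def)
  qed
  ultimately show ?thesis by (simp add: symmetric_forms_def continuous_forms_def)
qed

lemma norm_mixed_form_le:
  assumes f: "\<And>x. norm (f x) \<le> norm x" and h: "\<And>x. norm (h x) \<le> norm x"
  shows "norm (mixed_form n h f x) \<le> n * (\<Prod>i<n. norm (x i))"
proof -
  have "norm (mixed_form n h f x) \<le> (\<Sum>i<n. \<Prod>j<n. norm (x j))"
    unfolding mixed_form_def
  proof (intro sum_norm_le)
    fix i
    show "norm (\<Prod>j<n. if j = i then f (x j) else h (x j)) \<le> (\<Prod>j<n. norm (x j))"
      unfolding prod_norm[symmetric] using f h by (intro prod_mono) auto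
  qed
  then show ?thesis by simp
qed

text \<open>
  Here \<open>n \<ge> 3\<close> enters: each summand of the mixed form contains two factors \<open>h\<close>, so that it is
  dominated by the quadratic gap which the \<open>h (x i)\<close> leave in \<open>\<phi> (x i)\<close>.
\<close>

lemma norm_power_plus_mixed_form_le:
  assumes n: "n \<ge> 3" and f: "\<And>x. norm (f x) \<le> norm x"
    and \<phi>h: "\<And>x. (norm (\<phi> x))\<^sup>2 + (norm (h x))\<^sup>2 \<le> (norm x)\<^sup>2"
    and x: "\<forall>i<n. norm (x i) \<le> 1"
  shows "norm ((\<Prod>i<n. \<phi> (x i)) + of_real (1 / (2 * real n ^ 2)) * mixed_form n h f x) \<le> 1"
proof -
  define S where "S = (\<Sum>i<n. (norm (h (x i)))\<^sup>2)"
  have le1: "(norm (\<phi> (x i)))\<^sup>2 + (norm (h (x i)))\<^sup>2 \<le> 1" if "i < n" for i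
    using \<phi>h[of "x i"] x that power_le_one[of "norm (x i)" 2] by fastforce
  have h1: "norm (h (x i)) \<le> 1" and \<phi>1: "norm (\<phi> (x i)) \<le> 1" if "i < n" for i
  proof -
    have "(norm (h (x i)))\<^sup>2 \<le> 1" "(norm (\<phi> (x i)))\<^sup>2 \<le> 1"
      using le1[OF that] zero_le_power2[of "norm (\<phi> (x i))"] zero_le_power2[of "norm (h (x i))"]
      by linarith+
    then show "norm (h (x i)) \<le> 1" "norm (\<phi> (x i)) \<le> 1" by (simp_all add: abs_square_le_1)
  qed
  have Sle: "(norm (h (x i)))\<^sup>2 \<le> S" if "i < n" for i
    unfolding S_def using that by (intro member_le_sum) auto
  \<comment> \<open>The other factors are at most 1. With \<open>s\<close> for the square of
    \<open>norm (h (x i))\<close>, squaring reduces the bound to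
    \<open>1 - s \<le> (1 - s / 2)\<^sup>2\<close>.\<close>
  have "norm (\<Prod>i<n. \<phi> (x i)) \<le> 1 - (norm (h (x i)))\<^sup>2 / 2" if i: "i < n" for i
  proof -
    have "norm (\<Prod>i<n. \<phi> (x i)) = norm (\<phi> (x i)) * (\<Prod>j\<in>{..<n} - {i}. norm (\<phi> (x j)))"
      unfolding prod_norm[symmetric] using i by (intro prod.remove) auto
    also have "\<dots> \<le> norm (\<phi> (x i)) * 1"
      using \<phi>1 by (intro mult_left_mono prod_le_1) auto
    also have "\<dots> \<le> 1 - (norm (h (x i)))\<^sup>2 / 2"
    proof (rule power2_le_imp_le)
      have "(norm (h (x i)))\<^sup>2 \<le> 1" using h1[OF i] by (simp add: power_le_one)
      then show "0 \<le> 1 - (norm (h (x i)))\<^sup>2 / 2" by simp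
      have "(1 - (norm (h (x i)))\<^sup>2 / 2)\<^sup>2 = 1 - (norm (h (x i)))\<^sup>2 + ((norm (h (x i)))\<^sup>2 / 2)\<^sup>2"
        by (simp add: power2_eq_square algebra_simps)
      then show "(norm (\<phi> (x i)) * 1)\<^sup>2 \<le> (1 - (norm (h (x i)))\<^sup>2 / 2)\<^sup>2"
        using le1[OF i] zero_le_power2[of "(norm (h (x i)))\<^sup>2 / 2"] unfolding mult_1_right by linarith
    qed
    finally show ?thesis .
  qed
  \<comment> \<open>Averaging these \<open>n\<close> bounds lets all arguments share in the gap: the
    product is at most \<open>1 - S / (2 * n)\<close>.\<close>
  then have "(\<Sum>i<n. norm (\<Prod>i<n. \<phi> (x i))) \<le> (\<Sum>i<n. 1 - (norm (h (x i)))\<^sup>2 / 2)"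
    by (intro sum_mono) auto
  also have "\<dots> = n - S / 2" by (simp add: S_def sum_subtractf sum_divide_distrib)
  finally have prod: "n * norm (\<Prod>i<n. \<phi> (x i)) \<le> n - S / 2" by simp
  have "norm (\<Prod>j<n. if j = i then f (x j) else h (x j)) \<le> S" if i: "i < n" for i
  proof -
    obtain j k where jk: "j < n" "k < n" "j \<noteq> i" "k \<noteq> i" "j \<noteq> k"
    proof (cases "i = 0")
      case True then show ?thesis using that[of 1 2] n by auto
    next
      case False then show ?thesis using that[of 0 "if i = 1 then 2 else 1"] n by auto
    qed
    define g where "g l = norm (if l = i then f (x l) else h (x l))" for l
    have g: "0 \<le> g l" "l < n \<Longrightarrow> g l \<le> 1" for l
      using f[of "x l"] x h1 by (auto simp: g_def intro: order_trans)
    \<comment> \<open>All factors but those at \<open>j\<close> and \<open>k\<close> are bounded by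
      1, and the product of these two is at most the mean of their squares.\<close>
    have "(\<Prod>l<n. g l) = g j * (g k * (\<Prod>l\<in>{..<n} - {j} - {k}. g l))"
      using jk by (subst prod.remove[of _ j], simp, simp, subst prod.remove[of _ k]) auto
    also have "\<dots> \<le> g j * (g k * 1)"
      using g by (intro mult_left_mono prod_le_1) auto
    also have "\<dots> \<le> ((g j)\<^sup>2 + (g k)\<^sup>2) / 2"
      using sum_squares_bound[of "g j" "g k"] by simp
    also have "\<dots> \<le> S" using jk Sle[of j] Sle[of k] by (simp add: g_def)
    finally show ?thesis unfolding g_def prod_norm .
  qed
  then have "norm (mixed_form n h f x) \<le> (\<Sum>i<n. S)"
    unfolding mixed_form_def by (intro sum_norm_le) auto
  \<comment> \<open>The factor is chosen so that the \<open>n\<close> summands, each at most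
    \<open>S\<close>, together fit into the gap \<open>S / (2 * n)\<close>.\<close>
  then have "1 / (2 * real n ^ 2) * norm (mixed_form n h f x) \<le> 1 / (2 * real n ^ 2) * (n * S)"
    by (intro mult_left_mono) auto
  also have "\<dots> = S / (2 * n)" using n by (simp add: power2_eq_square)
  finally have "1 / (2 * real n ^ 2) * norm (mixed_form n h f x) \<le> S / (2 * n)" .
  moreover have "norm (\<Prod>i<n. \<phi> (x i)) \<le> 1 - S / (2 * n)"
    using prod n by (simp add: field_simps)
  moreover have "norm (of_real (1 / (2 * real n ^ 2)) * mixed_form n h f x) =
      1 / (2 * real n ^ 2) * norm (mixed_form n h f x)"
    by (simp only: norm_mult norm_of_real) simp
  ultimately show ?thesis
    using norm_triangle_ineq[of "\<Prod>i<n. \<phi> (x i)" "of_real (1 / (2 * real n ^ 2)) * mixed_form n h f x"]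
    by linarith
qed

text \<open>Only the summand with \<open>f\<close> in slot 0 contains \<open>f y\<close>; each of
  the others has a factor \<open>f x0\<close>, which becomes small along a weak-star null sequence,
  and further factors at most 1.\<close>

lemma norm_mixed_form_ge:
  assumes n: "n \<ge> 3" and f: "\<And>x. norm (f x) \<le> norm x" and h: "\<And>x. norm (h x) \<le> norm x"
    and x0: "norm x0 \<le> 1" and y: "norm y \<le> 1"
  shows "norm (f y) * norm (h x0) ^ (n - 1) - n * norm (f x0) \<le>
    norm (mixed_form n h f (\<lambda>i. if i = 0 then y else x0))"
proof -
  define T where "T i = (\<Prod>j<n. if j = i then f (if j = 0 then y else x0) else h (if j = 0 then y else x0))" for i
  have "T 0 = f y * h x0 ^ (n - 1)"
  proof -
    have "T 0 = f y * (\<Prod>j\<in>{..<n} - {0}. h x0)"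
      unfolding T_def using n by (subst prod.remove[of _ 0]) (auto intro!: prod.cong)
    then show ?thesis using n by simp
  qed
  moreover have "norm (\<Sum>i\<in>{..<n} - {0}. T i) \<le> (\<Sum>i\<in>{..<n} - {0}. norm (f x0))"
  proof (rule sum_norm_le)
    fix i assume i: "i \<in> {..<n} - {0}"
    have "norm (T i) = norm (f x0) * (\<Prod>j\<in>{..<n} - {i}. norm (h (if j = 0 then y else x0)))"
      unfolding T_def prod_norm[symmetric] using i by (subst prod.remove[of _ i]) (auto intro!: prod.cong)
    also have "\<dots> \<le> norm (f x0) * 1"
      using order_trans[OF h[of y] y] order_trans[OF h[of x0] x0] by (intro mult_left_mono prod_le_1) auto
    finally show "norm (T i) \<le> norm (f x0)" by simp
  qed
  moreover have "(\<Sum>i\<in>{..<n} - {0}. norm (f x0)) \<le> n * norm (f x0)"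
    using n by (simp add: mult_right_mono)
  moreover have "mixed_form n h f (\<lambda>i. if i = 0 then y else x0) = T 0 + (\<Sum>i\<in>{..<n} - {0}. T i)"
    unfolding mixed_form_def T_def using n by (subst sum.remove[of _ 0]) auto
  ultimately show ?thesis
    using norm_diff_ineq[of "T 0" "\<Sum>i\<in>{..<n} - {0}. T i"] by (simp add: norm_mult norm_power)
qed

end

section \<open>Failure of the Kadec-Klee property\<close>

lemma (in normed_space_over) not_sequential_weak_star_KK:
  assumes n: "n \<ge> 3" and \<phi>: "functional \<phi>" and h: "functional h"
    and \<phi>h: "\<And>x. (norm (\<phi> x))\<^sup>2 + (norm (h x))\<^sup>2 \<le> (norm x)\<^sup>2"
    and z: "\<And>k. norm (z k) \<le> 1" "(\<lambda>k. norm (\<phi> (z k))) \<longlonglongrightarrow> 1"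
    and x0: "norm x0 \<le> 1" "h x0 \<noteq> 0"
    and \<psi>: "\<And>m. functional (\<psi> m)" "\<And>m x. norm (\<psi> m x) \<le> norm x" "\<And>x. (\<lambda>m. \<psi> m x) \<longlonglongrightarrow> 0"
    and \<delta>: "\<delta> > 0" "\<And>m. \<exists>y. norm y \<le> 1 \<and> norm (\<psi> m y) \<ge> \<delta>"
  shows "\<not> symmetric_forms_sequential_weak_star_KK smul n"
proof
  assume KK: "symmetric_forms_sequential_weak_star_KK smul n"
  have \<phi>le: "norm (\<phi> x) \<le> norm x" and hle: "norm (h x) \<le> norm x" for x
  proof -
    have "(norm (\<phi> x))\<^sup>2 \<le> (norm x)\<^sup>2" "(norm (h x))\<^sup>2 \<le> (norm x)\<^sup>2"
      using \<phi>h[of x] zero_le_power2[of "norm (\<phi> x)"] zero_le_power2[of "norm (h x)"] by linarith+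
    then show "norm (\<phi> x) \<le> norm x" "norm (h x) \<le> norm x"
      using power2_le_imp_le[OF _ norm_ge_zero] by blast+
  qed
  define \<epsilon> where "\<epsilon> = 1 / (2 * real n ^ 2)"
  \<comment> \<open>\<open>\<epsilon> * n \<le> 1\<close> bounds the perturbation by the product of
    the norms, hence the constant 2 in \<open>G_le\<close>.\<close>
  have \<epsilon>: "\<epsilon> > 0" "\<epsilon> * n \<le> 1" using n by (auto simp: \<epsilon>_def power2_eq_square field_simps)
  define A where "A x = (\<Prod>i<n. \<phi> (x i))" for x
  define G where "G m x = A x + of_real \<epsilon> * mixed_form n h (\<psi> m) x" for m x
  define t where "t m = form_norm n (G m)" for m
  have A: "A \<in> symmetric_forms smul n"
    unfolding A_def by (rule power_symmetric_form[OF \<phi> \<phi>le])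
  have G: "G m \<in> symmetric_forms smul n" for m
    unfolding G_def
    by (intro symmetric_forms_add symmetric_forms_mult A mixed_form_symmetric \<psi> h hle)
  have G_le_1: "norm (G m x) \<le> 1" if "\<forall>i<n. norm (x i) \<le> 1" for m x
    unfolding G_def A_def \<epsilon>_def by (rule norm_power_plus_mixed_form_le[OF n \<psi>(2) \<phi>h that])
  have A_le: "norm (A x) \<le> (\<Prod>i<n. norm (x i))" for x
    unfolding A_def prod_norm[symmetric] by (intro prod_mono) (auto simp: \<phi>le)
  have A_le_1: "norm (A x) \<le> 1" if "\<forall>i<n. norm (x i) \<le> 1" for x
    using A_le[of x] prod_le_1[of "{..<n}" "\<lambda>i. norm (x i)"] that by fastforce
  have G_le: "norm (G m x) \<le> 2 * (\<Prod>i<n. norm (x i))" for m x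
  proof -
    have "norm (G m x) \<le> norm (A x) + \<epsilon> * norm (mixed_form n h (\<psi> m) x)"
      unfolding G_def using norm_triangle_ineq[of "A x" "of_real \<epsilon> * mixed_form n h (\<psi> m) x"] \<epsilon>(1)
      by (simp add: norm_mult)
    also have "\<dots> \<le> (\<Prod>i<n. norm (x i)) + \<epsilon> * (n * (\<Prod>i<n. norm (x i)))"
      using A_le \<epsilon>(1) by (intro add_mono mult_left_mono norm_mixed_form_le \<psi> hle) auto
    also have "\<dots> \<le> 2 * (\<Prod>i<n. norm (x i))"
      using mult_right_mono[OF \<epsilon>(2), of "\<Prod>i<n. norm (x i)"] by (simp add: prod_nonneg mult.assoc)
    finally show ?thesis .
  qed
  \<comment> \<open>Every summand of the mixed form has exactly one factor \<open>\<psi> m\<close>,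
    which tends to 0 at a fixed argument.\<close>
  have G_lim: "(\<lambda>m. G m x) \<longlonglongrightarrow> A x" for x
  proof -
    have "(\<lambda>m. mixed_form n h (\<psi> m) x) \<longlonglongrightarrow>
        (\<Sum>i<n. \<Prod>j<n. if j = i then 0 else h (x j))"
      unfolding mixed_form_def
    proof (intro tendsto_sum tendsto_prod)
      fix i j
      show "(\<lambda>m. if j = i then \<psi> m (x j) else h (x j)) \<longlonglongrightarrow> (if j = i then 0 else h (x j))"
        using \<psi>(3) by (cases "j = i") auto
    qed
    also have "(\<Sum>i<n. \<Prod>j<n. if j = i then 0 else h (x j)) = 0"
      by (intro sum.neutral ballI prod_zero) auto
    finally show ?thesis
      unfolding G_def by (auto intro!: tendsto_eq_intros)
  qed
  have pow: "(\<lambda>k. norm (\<phi> (z k)) ^ n) \<longlonglongrightarrow> 1"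
    using tendsto_power[OF z(2), of n] by simp
  have Az: "norm (A (\<lambda>_. z k)) = norm (\<phi> (z k)) ^ n" for k
    by (simp add: A_def norm_power)
  have normA: "form_norm n A = 1"
  proof (rule antisym)
    show "form_norm n A \<le> 1" by (rule form_norm_least[OF A_le_1])
    have "norm (\<phi> (z k)) ^ n \<le> form_norm n A" for k
      unfolding Az[symmetric] using form_norm_upper[OF A_le_1, where x = "\<lambda>_. z k"] z(1) by simp
    then show "1 \<le> form_norm n A" by (intro LIMSEQ_le_const2[OF pow]) auto
  qed
  have t_le: "t m \<le> 1" for m unfolding t_def by (rule form_norm_least[OF G_le_1])
  \<comment> \<open>Points nearly norming \<open>A\<close> give the lower bound through pointwise
    convergence; the upper bound is \<open>t_le\<close>.\<close>
  have t: "t \<longlonglongrightarrow> 1"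
  proof (rule order_tendstoI)
    fix a :: real assume "a < 1"
    then have "eventually (\<lambda>k. a < norm (\<phi> (z k)) ^ n) sequentially"
      using order_tendstoD(1)[OF pow] by blast
    then obtain k where "a < norm (A (\<lambda>_. z k))" by (auto simp: Az eventually_sequentially)
    then have "eventually (\<lambda>m. a < norm (G m (\<lambda>_. z k))) sequentially"
      by (rule order_tendstoD(1)[OF tendsto_norm[OF G_lim]])
    then show "eventually (\<lambda>m. a < t m) sequentially"
    proof eventually_elim
      case (elim m)
      have "norm (G m (\<lambda>_. z k)) \<le> t m"
        unfolding t_def using z(1) by (intro form_norm_upper[OF G_le_1]) auto
      with elim show ?case by simp
    qed
  next
    fix a :: real assume "1 < a"
    then show "eventually (\<lambda>m. t m < a) sequentially"
      using t_le by (intro always_eventually) (auto intro: le_less_trans)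
  qed
  then have "eventually (\<lambda>m. t m > 1/2) sequentially"
    by (rule order_tendstoD(1)) simp
  then obtain M where M: "\<And>m. m \<ge> M \<Longrightarrow> t m > 1/2" by (auto simp: eventually_sequentially)
  \<comment> \<open>The shift by \<open>M\<close> leaves only norms above 1/2, so that normalization
    at most doubles a form.\<close>
  define F where "F m x = of_real (inverse (t (m + M))) * G (m + M) x" for m x
  have tM: "t (m + M) > 1/2" for m by (rule M) simp
  have F: "F m \<in> symmetric_forms smul n" for m
    unfolding F_def by (intro symmetric_forms_mult G)
  have normF: "norm (F m x) = inverse (t (m + M)) * norm (G (m + M) x)" for m x
    unfolding F_def norm_mult norm_of_real using tM[of m] by simp
  have F_le: "norm (F m x) \<le> 2 * norm (G (m + M) x)" for m x
    unfolding normF using tM[of m] by (intro mult_right_mono) (auto simp: field_simps)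
  have F_le_2: "norm (F m x) \<le> 2" if "\<forall>i<n. norm (x i) \<le> 1" for m x
    using F_le[of m x] G_le_1[OF that, of "m + M"] by simp
  have normF1: "form_norm n (F m) = 1" for m
  proof (rule antisym)
    have "norm (F m x) \<le> 1" if x: "\<forall>i<n. norm (x i) \<le> 1" for x
    proof -
      have "norm (G (m + M) x) \<le> t (m + M)"
        unfolding t_def using x by (intro form_norm_upper[OF G_le_1]) auto
      then show ?thesis unfolding normF using tM[of m] by (simp add: field_simps)
    qed
    then show "form_norm n (F m) \<le> 1" by (rule form_norm_least)
    have "t (m + M) \<le> t (m + M) * form_norm n (F m)"
      unfolding t_def[of "m + M"]
    proof (rule form_norm_least)
      fix x :: "nat \<Rightarrow> 'x" assume x: "\<forall>i<n. norm (x i) \<le> 1"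
      have "norm (F m x) \<le> form_norm n (F m)" by (rule form_norm_upper[OF F_le_2 x])
      then show "norm (G (m + M) x) \<le> form_norm n (G (m + M)) * form_norm n (F m)"
        unfolding normF using tM[of m] by (simp add: field_simps t_def)
    qed
    then show "1 \<le> form_norm n (F m)" using tM[of m] by simp
  qed
  have t': "(\<lambda>m. t (m + M)) \<longlonglongrightarrow> 1" using t by (rule LIMSEQ_ignore_initial_segment)
  have "weak_star_tendsto smul n F A"
  proof (rule weak_star_tendsto_bounded[OF F A])
    show "norm (F m x) \<le> 4 * (\<Prod>i<n. norm (x i))" for m x
      using F_le[of m x] G_le[of "m + M" x] by simp
    show "norm (A x) \<le> 4 * (\<Prod>i<n. norm (x i))" for x
      using A_le[of x] prod_nonneg[of "{..<n}" "\<lambda>i. norm (x i)"] by simp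
    show "(\<lambda>m. F m x) \<longlonglongrightarrow> A x" for x
      unfolding F_def
      by (rule tendsto_eq_rhs[OF tendsto_mult[OF tendsto_of_real[OF tendsto_inverse[OF t']]
            LIMSEQ_ignore_initial_segment[OF G_lim]]]) auto
  qed simp
  then have conv: "(\<lambda>m. form_norm n (\<lambda>x. F m x - A x)) \<longlonglongrightarrow> 0"
    using KK F A normA normF1 unfolding symmetric_forms_sequential_weak_star_KK_def by blast
  \<comment> \<open>The perturbation \<open>G - A\<close> also equals
    \<open>t (F - A) + (t - 1) A\<close>, which bounds it by the distance of \<open>F\<close> from
    \<open>A\<close> plus \<open>1 - t\<close>. It is bounded below at the point with
    \<open>y\<close> in slot 0 and \<open>x0\<close> elsewhere.\<close>
  have gap: "\<epsilon> * (\<delta> * norm (h x0) ^ (n - 1) - n * norm (\<psi> (m + M) x0)) \<le>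
      form_norm n (\<lambda>x. F m x - A x) + (1 - t (m + M))" for m
  proof -
    obtain y where y: "norm y \<le> 1" "norm (\<psi> (m + M) y) \<ge> \<delta>" using \<delta>(2) by blast
    define p where "p i = (if i = 0 then y else x0)" for i :: nat
    have p: "\<forall>i<n. norm (p i) \<le> 1" using y(1) x0(1) by (simp add: p_def)
    have "\<epsilon> * (\<delta> * norm (h x0) ^ (n - 1) - n * norm (\<psi> (m + M) x0)) \<le>
        \<epsilon> * (norm (\<psi> (m + M) y) * norm (h x0) ^ (n - 1) - n * norm (\<psi> (m + M) x0))"
      using \<epsilon>(1) y(2) by (intro mult_left_mono diff_right_mono mult_right_mono) auto
    also have "\<dots> \<le> \<epsilon> * norm (mixed_form n h (\<psi> (m + M)) p)"
      unfolding p_def using \<epsilon>(1)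
      by (intro mult_left_mono norm_mixed_form_ge[OF n \<psi>(2) hle x0(1) y(1)]) auto
    also have "\<dots> = norm (G (m + M) p - A p)"
      using \<epsilon>(1) by (simp add: G_def norm_mult)
    also have "\<dots> = norm (of_real (t (m + M)) * (F m p - A p) + of_real (t (m + M) - 1) * A p)"
      using tM[of m] by (simp add: F_def algebra_simps)
    also have "\<dots> \<le> t (m + M) * norm (F m p - A p) + (1 - t (m + M)) * norm (A p)"
    proof -
      have "norm (of_real (t (m + M) - 1) * A p) = (1 - t (m + M)) * norm (A p)"
        unfolding norm_mult norm_of_real using t_le[of "m + M"] by simp
      moreover have "norm (of_real (t (m + M)) * (F m p - A p)) = t (m + M) * norm (F m p - A p)"
        unfolding norm_mult norm_of_real using tM[of m] by simp
      ultimately show ?thesis using norm_triangle_ineq by metis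
    qed
    also have "\<dots> \<le> 1 * norm (F m p - A p) + (1 - t (m + M)) * 1"
      using t_le[of "m + M"] A_le_1[OF p] by (intro add_mono mult_right_mono mult_left_mono) auto
    also have "norm (F m p - A p) \<le> form_norm n (\<lambda>x. F m x - A x)"
    proof (rule form_norm_upper[OF _ p])
      show "norm (F m x - A x) \<le> 3" if "\<forall>i<n. norm (x i) \<le> 1" for x
        using norm_triangle_ineq4[of "F m x" "A x"] F_le_2[OF that, of m] A_le_1[OF that] by simp
    qed
    finally show ?thesis by simp
  qed
  have lhs: "(\<lambda>m. \<epsilon> * (\<delta> * norm (h x0) ^ (n - 1) - n * norm (\<psi> (m + M) x0)))
      \<longlonglongrightarrow> \<epsilon> * (\<delta> * norm (h x0) ^ (n - 1) - n * norm (0 :: 'k))"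
    by (intro tendsto_intros LIMSEQ_ignore_initial_segment \<psi>(3))
  have rhs: "(\<lambda>m. form_norm n (\<lambda>x. F m x - A x) + (1 - t (m + M))) \<longlonglongrightarrow> 0 + (1 - 1)"
    by (intro tendsto_intros conv t')
  \<comment> \<open>In the limit the distance, \<open>1 - t\<close> and the values at
    \<open>x0\<close> vanish, while a positive term remains on the left.\<close>
  have "\<epsilon> * (\<delta> * norm (h x0) ^ (n - 1) - n * norm (0 :: 'k)) \<le> 0 + (1 - 1)"
    by (rule LIMSEQ_le[OF lhs rhs]) (use gap in auto)
  moreover have "\<epsilon> * (\<delta> * norm (h x0) ^ (n - 1)) > 0" using \<epsilon>(1) \<delta>(1) x0(2) by simp
  ultimately show False by simp
qed

text \<open>
  The ellipse of the form \<open>(norm u)\<^sup>2 + (norm v)\<^sup>2 \<le> M\<close> which circumscribes the image of the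
  unit ball under \<open>(f, g)\<close> touches it at some \<open>(a, b)\<close>; rotating \<open>(a, b)\<close> to the first axis
  gives the pair \<open>\<phi>\<close>, \<open>h\<close>.
\<close>

lemma circumscribed_ellipse:
  fixes smul :: "'k::{real_normed_field, heine_borel} \<Rightarrow> 'x::real_normed_vector \<Rightarrow> 'x" and cj :: "'k \<Rightarrow> 'k"
  assumes sm: "normed_space_over smul"
    and f: "Vector_Spaces.linear smul (*) f" "\<And>x. norm (f x) \<le> norm x"
    and g: "Vector_Spaces.linear smul (*) g" "\<And>x. norm (g x) \<le> norm x"
    and indep: "f p * g q \<noteq> f q * g p"
    and cj: "\<And>a b. cj (a + b) = cj a + cj b" "\<And>a b. cj (a * b) = cj a * cj b" "\<And>a. cj (cj a) = a"
      "\<And>a. of_real ((norm a)\<^sup>2) = cj a * a"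
  obtains \<phi> h z x0 where "Vector_Spaces.linear smul (*) \<phi>" "Vector_Spaces.linear smul (*) h"
    "\<forall>x. (norm (\<phi> x))\<^sup>2 + (norm (h x))\<^sup>2 \<le> (norm x)\<^sup>2"
    "\<forall>k :: nat. norm (z k) \<le> 1" "(\<lambda>k. norm (\<phi> (z k))) \<longlonglongrightarrow> 1"
    "norm x0 \<le> 1" "h x0 \<noteq> 0"
proof -
  interpret normed_space_over smul by (rule sm)
  have cj_minus: "cj (a - b) = cj a - cj b" for a b
    using cj(1)[of "a - b" b] by (simp add: algebra_simps)
  \<comment> \<open>Lagrange's identity, checked in the scalar field through
    \<open>cj a * a\<close>. Here \<open>cj\<close> models the identity for real and conjugation for
    complex scalars.\<close>
  have rotate: "(norm (cj a * u + cj b * v))\<^sup>2 + (norm (b * u - a * v))\<^sup>2 =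
      ((norm a)\<^sup>2 + (norm b)\<^sup>2) * ((norm u)\<^sup>2 + (norm v)\<^sup>2)" for a b u v
  proof -
    have "(of_real ((norm (cj a * u + cj b * v))\<^sup>2 + (norm (b * u - a * v))\<^sup>2) :: 'k) =
        of_real (((norm a)\<^sup>2 + (norm b)\<^sup>2) * ((norm u)\<^sup>2 + (norm v)\<^sup>2))"
      unfolding of_real_add of_real_mult cj(4) by (simp add: cj cj_minus algebra_simps)
    then show ?thesis by (simp only: of_real_eq_iff)
  qed
  define q2 where "q2 x = (norm (f x))\<^sup>2 + (norm (g x))\<^sup>2" for x
  have q2_le: "q2 x \<le> 2" if "norm x \<le> 1" for x
    using power_mono[of "norm (f x)" 1 2] power_mono[of "norm (g x)" 1 2] f(2)[of x] g(2)[of x] that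
    by (simp add: q2_def)
  define M where "M = (SUP x\<in>{x. norm x \<le> 1}. q2 x)"
  have bdd: "bdd_above (q2 ` {x. norm x \<le> 1})" using q2_le by (intro bdd_aboveI2[where M = 2]) auto
  have upper: "q2 x \<le> M" if "norm x \<le> 1" for x
    unfolding M_def using that by (intro cSUP_upper bdd) auto
  \<comment> \<open>Normalization is written with \<open>smul\<close>, so that functionals commute
    with it; \<open>unit 0\<close> is 0.\<close>
  define unit where "unit x = smul (of_real (inverse (norm x))) x" for x
  have unit: "norm (unit x) \<le> 1" for x
    unfolding unit_def norm_smul norm_of_real by (cases "x = 0") auto
  have hom: "u x = of_real (norm x) * u (unit x)" if "functional u" for u x
  proof (cases "x = 0")
    case True
    have "u 0 = u 0 + u 0" using that unfolding functional_iff by (metis add_0)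
    then show ?thesis using True by simp
  qed (use that in \<open>simp add: functional_iff unit_def\<close>)
  have scale: "q2 x \<le> M * (norm x)\<^sup>2" for x
  proof -
    have "q2 x = (norm x)\<^sup>2 * q2 (unit x)"
      unfolding q2_def hom[OF f(1), of x] hom[OF g(1), of x]
      by (simp add: norm_mult power_mult_distrib algebra_simps)
    also have "\<dots> \<le> (norm x)\<^sup>2 * M" by (intro mult_left_mono upper unit) auto
    finally show ?thesis by (simp add: mult.commute)
  qed
  have "\<exists>x. q2 x > 0"
  proof (rule ccontr)
    assume "\<not> ?thesis"
    then have "q2 p = 0" using zero_le_power2[of "norm (f p)"] zero_le_power2[of "norm (g p)"]
      unfolding q2_def by (meson add_nonneg_nonneg antisym not_less zero_le_power2)
    then show False using indep by (simp add: q2_def add_nonneg_eq_0_iff)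
  qed
  then obtain x where "0 < q2 x" by blast
  then have "0 < M * (norm x)\<^sup>2" using scale by (rule less_le_trans)
  then have Mpos: "M > 0" by (simp add: zero_less_mult_iff)
  have "\<exists>x. norm x \<le> 1 \<and> M - 1 / Suc k < q2 x" for k
  proof -
    have "M - 1 / Suc k < M" by simp
    then show ?thesis
      unfolding M_def by (subst (asm) less_cSUP_iff) (use bdd in \<open>auto intro: exI[of _ 0]\<close>)
  qed
  then obtain y where y: "\<And>k. norm (y k) \<le> 1" "\<And>k. M - 1 / Suc k < q2 (y k)" by metis
  have q2y: "(\<lambda>k. q2 (y k)) \<longlonglongrightarrow> M"
  proof (rule tendsto_sandwich)
    show "(\<lambda>k. M - 1 / real (Suc k)) \<longlonglongrightarrow> M"
      using tendsto_diff[OF tendsto_const LIMSEQ_Suc[OF lim_1_over_n], of M] by simp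
    show "eventually (\<lambda>k. M - 1 / real (Suc k) \<le> q2 (y k)) sequentially"
      using less_imp_le[OF y(2)] by (intro always_eventually allI) simp
    show "eventually (\<lambda>k. q2 (y k) \<le> M) sequentially"
      using upper[OF y(1)] by (intro always_eventually allI) simp
  qed simp
  \<comment> \<open>Compactness is available for the pairs of values, not for the unit ball; hence
    \<open>(a, b)\<close> is a limit of values, and \<open>\<phi>\<close> is normed along a sequence
    of points.\<close>
  have "bounded (range (\<lambda>k. (f (y k), g (y k))))"
  proof (rule boundedI)
    fix w assume "w \<in> range (\<lambda>k. (f (y k), g (y k)))"
    then obtain k where w: "w = (f (y k), g (y k))" by blast
    have "norm w \<le> norm (f (y k)) + norm (g (y k))" unfolding w by (rule norm_Pair_le)
    also have "\<dots> \<le> 1 + 1"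
      using f(2)[of "y k"] g(2)[of "y k"] y(1)[of k] by (intro add_mono) auto
    finally show "norm w \<le> 2" by simp
  qed
  then obtain l r where r: "strict_mono r" "((\<lambda>k. (f (y k), g (y k))) \<circ> r) \<longlonglongrightarrow> l"
    using bounded_imp_convergent_subsequence by blast
  define a b where "a = fst l" and "b = snd l"
  have lim: "(\<lambda>k. f (y (r k))) \<longlonglongrightarrow> a" "(\<lambda>k. g (y (r k))) \<longlonglongrightarrow> b"
    using tendsto_fst[OF r(2)] tendsto_snd[OF r(2)] by (auto simp: a_def b_def comp_def)
  have "(\<lambda>k. q2 (y (r k))) \<longlonglongrightarrow> (norm a)\<^sup>2 + (norm b)\<^sup>2"
    unfolding q2_def by (intro tendsto_intros lim)
  moreover have "(\<lambda>k. q2 (y (r k))) \<longlonglongrightarrow> M"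
    using LIMSEQ_subseq_LIMSEQ[OF q2y r(1)] by (simp add: comp_def)
  ultimately have ab: "(norm a)\<^sup>2 + (norm b)\<^sup>2 = M" by (rule LIMSEQ_unique)
  \<comment> \<open>At \<open>(f x, g x) = (a, b)\<close> the two functionals take the values 1 and
    0, and \<open>rotate\<close> makes the sum of their squares equal to
    \<open>q2 x / M\<close>.\<close>
  define \<phi> where "\<phi> x = (cj a * f x + cj b * g x) / of_real M" for x
  define h where "h x = (b * f x - a * g x) / of_real M" for x
  have \<phi>: "functional \<phi>" and h: "functional h"
    using f(1) g(1) by (auto simp: functional_iff \<phi>_def h_def algebra_simps add_divide_distrib diff_divide_distrib)
  have \<phi>h: "(norm (\<phi> x))\<^sup>2 + (norm (h x))\<^sup>2 \<le> (norm x)\<^sup>2" for x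
  proof -
    have "(norm (\<phi> x))\<^sup>2 + (norm (h x))\<^sup>2 =
        ((norm (cj a * f x + cj b * g x))\<^sup>2 + (norm (b * f x - a * g x))\<^sup>2) / M\<^sup>2"
      by (simp add: \<phi>_def h_def norm_divide power_divide flip: add_divide_distrib)
    also have "\<dots> = q2 x / M"
      unfolding rotate ab using Mpos by (simp add: q2_def power2_eq_square)
    also have "\<dots> \<le> (norm x)\<^sup>2" using scale[of x] Mpos by (simp add: field_simps)
    finally show ?thesis .
  qed
  have "(\<lambda>k. norm (\<phi> (y (r k)))) \<longlonglongrightarrow> norm ((cj a * a + cj b * b) / of_real M)"
    unfolding \<phi>_def using Mpos by (intro tendsto_intros lim) auto
  also have "(cj a * a + cj b * b) / of_real M = 1"
    unfolding cj(4)[symmetric] of_real_add[symmetric] ab using Mpos by simp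
  finally have \<phi>y: "(\<lambda>k. norm (\<phi> (y (r k)))) \<longlonglongrightarrow> 1" by simp
  \<comment> \<open>If \<open>h\<close> vanished, both \<open>a\<close> and \<open>b\<close> would
    give 0 when multiplied by the nonzero determinant of \<open>f\<close> and \<open>g\<close> at
    \<open>p\<close>, \<open>q\<close>, contrary to \<open>M > 0\<close>.\<close>
  have "\<exists>x. h x \<noteq> 0"
  proof (rule ccontr)
    assume "\<not> ?thesis"
    then have eq: "b * f x = a * g x" for x using Mpos by (auto simp: h_def)
    have "b * (f p * g q - f q * g p) = (b * f p) * g q - (b * f q) * g p"
      by (simp add: algebra_simps)
    also have "\<dots> = 0" unfolding eq by simp
    finally have "b * (f p * g q - f q * g p) = 0" .
    then have "b = 0" using indep by simp
    have "a * (f p * g q - f q * g p) = (a * g q) * f p - (a * g p) * f q"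
      by (simp add: algebra_simps)
    also have "\<dots> = 0" unfolding eq[symmetric] by simp
    finally have "a = 0" using indep by simp
    with \<open>b = 0\<close> show False using ab Mpos by simp
  qed
  then obtain x where "h x \<noteq> 0" by blast
  then have "h (unit x) \<noteq> 0" using hom[OF h, of x] by auto
  then show ?thesis using that[of \<phi> h "\<lambda>k. y (r k)" "unit x"] \<phi> h \<phi>h y(1) \<phi>y unit by blast
qed

text \<open>The sequence itself contains the two independent functionals for the ellipse: if all
  \<open>\<psi> m\<close> were proportional to \<open>\<psi> 0\<close>, their values at
  \<open>p\<close> would have modulus at least \<open>\<delta> * norm (\<psi> 0 p)\<close> and could
  not tend to 0.\<close>

lemma not_sequential_weak_star_KK_if_weak_star_null:
  fixes smul :: "'k::{real_normed_field, heine_borel} \<Rightarrow> 'x::real_normed_vector \<Rightarrow> 'x" and cj :: "'k \<Rightarrow> 'k"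
  assumes n: "n \<ge> 3" and sm: "normed_space_over smul"
    and cj: "\<And>a b. cj (a + b) = cj a + cj b" "\<And>a b. cj (a * b) = cj a * cj b" "\<And>a. cj (cj a) = a"
      "\<And>a. of_real ((norm a)\<^sup>2) = cj a * a"
    and \<psi>: "\<And>m. Vector_Spaces.linear smul (*) (\<psi> m)" "\<And>m x. norm (\<psi> m x) \<le> norm x"
      "\<And>x. (\<lambda>m. \<psi> m x) \<longlonglongrightarrow> 0"
    and \<delta>: "\<delta> > 0" "\<And>m. \<exists>y. norm y \<le> 1 \<and> norm (\<psi> m y) \<ge> \<delta>"
  shows "\<not> symmetric_forms_sequential_weak_star_KK smul n"
proof -
  interpret normed_space_over smul by (rule sm)
  obtain p where p: "norm (\<psi> 0 p) \<ge> \<delta>" using \<delta>(2)[of 0] by blast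
  then have p0: "\<psi> 0 p \<noteq> 0" using \<delta>(1) by auto
  have "\<exists>m q. \<psi> 0 p * \<psi> m q \<noteq> \<psi> 0 q * \<psi> m p"
  proof (rule ccontr)
    assume "\<not> ?thesis"
    then have eq: "\<psi> 0 p * \<psi> m q = \<psi> 0 q * \<psi> m p" for m q by blast
    have "\<delta> * norm (\<psi> 0 p) \<le> norm (\<psi> m p)" for m
    proof -
      obtain q where q: "norm q \<le> 1" "norm (\<psi> m q) \<ge> \<delta>" using \<delta>(2) by blast
      have "\<delta> * norm (\<psi> 0 p) \<le> norm (\<psi> m q) * norm (\<psi> 0 p)"
        using q(2) by (intro mult_right_mono) auto
      also have "\<dots> = norm (\<psi> 0 q) * norm (\<psi> m p)"
        using eq[of m q] by (metis mult.commute norm_mult)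
      also have "\<dots> \<le> 1 * norm (\<psi> m p)"
        using order_trans[OF \<psi>(2)[of 0 q] q(1)] by (intro mult_right_mono) auto
      finally show ?thesis by simp
    qed
    then have "\<delta> * norm (\<psi> 0 p) \<le> norm (0 :: 'k)"
      by (intro LIMSEQ_le_const[OF tendsto_norm[OF \<psi>(3)]]) auto
    then show False using \<delta>(1) p0 by (simp add: mult_le_0_iff)
  qed
  then obtain m q where mq: "\<psi> 0 p * \<psi> m q \<noteq> \<psi> 0 q * \<psi> m p" by blast
  obtain \<phi> h z x0 where *: "functional \<phi>" "functional h"
    "\<forall>x. (norm (\<phi> x))\<^sup>2 + (norm (h x))\<^sup>2 \<le> (norm x)\<^sup>2"
    "\<forall>k :: nat. norm (z k) \<le> 1" "(\<lambda>k. norm (\<phi> (z k))) \<longlonglongrightarrow> 1" "norm x0 \<le> 1" "h x0 \<noteq> 0"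
    using circumscribed_ellipse[OF sm \<psi>(1)[of 0] \<psi>(2)[of 0] \<psi>(1)[of m] \<psi>(2)[of m] mq cj] .
  show ?thesis
    by (rule not_sequential_weak_star_KK[OF n *(1,2) *(3,4)[rule_format] *(5,6,7) \<psi> \<delta>])
qed

section \<open>Passage between real and complex scalars\<close>

lemma infinite_dimensional_real:
  fixes smul :: "'k::real_normed_field \<Rightarrow> 'x::real_normed_vector \<Rightarrow> 'x"
  assumes sm: "normed_space_over smul" and inf: "infinite_dimensional smul"
  shows "\<nexists>B :: 'x set. finite B \<and> span B = UNIV"
proof
  assume "\<exists>B :: 'x set. finite B \<and> span B = UNIV"
  then obtain B :: "'x set" where B: "finite B" "span B = UNIV" by blast
  have "subspace (module.span smul B)" "B \<subseteq> module.span smul B"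
  proof -
    interpret normed_space_over smul by (rule sm)
    show "B \<subseteq> module.span smul B" by (rule span_superset)
    \<comment> \<open>The span over the scalar field is closed under real scaling, so a finite real
      spanning set would span over the field too.\<close>
    have "r *\<^sub>R x \<in> module.span smul B" if "x \<in> module.span smul B" for r x
      using span_scale[OF that, of "of_real r"] by (simp add: smul_of_real)
    then show "Real_Vector_Spaces.subspace (module.span smul B)"
      by (simp add: real_vector.subspace_def span_zero span_add)
  qed
  then have "span B \<subseteq> module.span smul B" by (intro span_minimal)
  then show False using inf B by (auto simp: infinite_dimensional_def)
qed

theorem theorem5p7:
  fixes smul :: "complex \<Rightarrow> 'y::banach \<Rightarrow> 'y" and n :: nat
  assumes "n \<ge> 3"
  shows "(infinite_dimensional (scaleR :: real \<Rightarrow> 'x::banach \<Rightarrow> 'x) \<longrightarrow>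
            \<not> symmetric_forms_sequential_weak_star_KK (scaleR :: real \<Rightarrow> 'x \<Rightarrow> 'x) n) \<and>
         (normed_space_over smul \<longrightarrow> infinite_dimensional smul \<longrightarrow>
            \<not> symmetric_forms_sequential_weak_star_KK smul n)"
proof (intro conjI impI)
  assume "infinite_dimensional (scaleR :: real \<Rightarrow> 'x \<Rightarrow> 'x)"
  then have "\<nexists>B :: 'x set. finite B \<and> span B = UNIV"
    by (simp add: infinite_dimensional_def span_raw_def)
  then obtain \<psi> :: "nat \<Rightarrow> 'x \<Rightarrow> real" and \<delta> where \<psi>: "\<forall>m. \<psi> m \<in> dual_ball"
    "\<forall>x. (\<lambda>m. \<psi> m x) \<longlonglongrightarrow> 0" "\<delta> > 0" "\<forall>m. \<exists>x. norm x \<le> 1 \<and> \<bar>\<psi> m x\<bar> \<ge> \<delta>"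
    by (rule Josefson_Nissenzweig)
  interpret normed_space_over "scaleR :: real \<Rightarrow> 'x \<Rightarrow> 'x"
    by unfold_locales (simp_all add: algebra_simps)
  have "functional (\<psi> m)" for m
    using \<psi>(1) by (simp add: functional_iff dual_ball_def linear_add linear_scale)
  then show "\<not> symmetric_forms_sequential_weak_star_KK (scaleR :: real \<Rightarrow> 'x \<Rightarrow> 'x) n"
    using \<psi> assms
    by (intro not_sequential_weak_star_KK_if_weak_star_null[where cj = id and \<psi> = \<psi> and \<delta> = \<delta>])
      (auto simp: power2_eq_square dual_ball_def intro: normed_space_over_axioms)
next
  assume sm: "normed_space_over smul" and inf: "infinite_dimensional smul"
  obtain \<psi> :: "nat \<Rightarrow> 'y \<Rightarrow> real" and \<delta> where \<psi>: "\<forall>m. \<psi> m \<in> dual_ball"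
    "\<forall>x. (\<lambda>m. \<psi> m x) \<longlonglongrightarrow> 0" "\<delta> > 0" "\<forall>m. \<exists>x. norm x \<le> 1 \<and> \<bar>\<psi> m x\<bar> \<ge> \<delta>"
    using Josefson_Nissenzweig[OF infinite_dimensional_real[OF sm inf]] .
  interpret normed_space_over smul by (rule sm)
  have smul_real: "smul (complex_of_real r) x = r *\<^sub>R x" for r x by (rule smul_of_real)
  have lin: "\<psi> m (x + y) = \<psi> m x + \<psi> m y" "\<psi> m (r *\<^sub>R x) = r * \<psi> m x" "\<bar>\<psi> m x\<bar> \<le> norm x" for m x y r
    using \<psi>(1) by (auto simp: dual_ball_def linear_add linear_scale)
  \<comment> \<open>The complex functional with real part \<open>\<psi> m / 2\<close>. The factor
    1/2 lets the bounds for real and imaginary part add up to \<open>norm x\<close>; it also halves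
    \<open>\<delta>\<close>.\<close>
  define \<Psi> where "\<Psi> m x = Complex (\<psi> m x / 2) (- \<psi> m (smul \<i> x) / 2)" for m x
  \<comment> \<open>Complex linearity is reduced to real linearity of \<open>\<psi> m\<close> at
    \<open>x\<close> and \<open>smul \<i> x\<close>.\<close>
  have smulE: "smul c x = Re c *\<^sub>R x + Im c *\<^sub>R smul \<i> x" for c x
  proof -
    have "smul c x = smul (of_real (Re c) + of_real (Im c) * \<i>) x"
      by (simp add: complex_eq mult.commute)
    also have "\<dots> = smul (of_real (Re c)) x + smul (of_real (Im c)) (smul \<i> x)"
      by (simp only: scale_left_distrib scale_scale)
    finally show ?thesis by (simp only: smul_real)
  qed
  have ii: "smul \<i> (smul \<i> x) = - x" for x
    by (simp add: scale_minus_left)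
  have \<Psi>: "functional (\<Psi> m)" for m
    unfolding functional_iff
  proof (intro conjI allI)
    show "\<Psi> m (x + y) = \<Psi> m x + \<Psi> m y" for x y
      by (simp add: \<Psi>_def lin scale_right_distrib complex_eq_iff add_divide_distrib)
    show "\<Psi> m (smul c x) = c * \<Psi> m x" for c x
    proof -
      have "smul \<i> (smul c x) = Re c *\<^sub>R smul \<i> x + (- Im c) *\<^sub>R x"
        using smulE[of "\<i> * c" x] by simp
      then have "\<psi> m (smul \<i> (smul c x)) = Re c * \<psi> m (smul \<i> x) + (- Im c) * \<psi> m x"
        by (simp only: lin)
      moreover have "\<psi> m (smul c x) = Re c * \<psi> m x + Im c * \<psi> m (smul \<i> x)"
        by (subst smulE) (simp only: lin)
      ultimately show ?thesis
        by (simp add: \<Psi>_def complex_eq_iff algebra_simps add_divide_distrib diff_divide_distrib)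
    qed
  qed
  have "norm (\<Psi> m x) \<le> norm x" for m x
  proof -
    have "norm (\<Psi> m x) \<le> \<bar>Re (\<Psi> m x)\<bar> + \<bar>Im (\<Psi> m x)\<bar>" by (rule cmod_le)
    also have "\<dots> \<le> norm x"
      using lin(3)[of m x] lin(3)[of m "smul \<i> x"] by (simp add: \<Psi>_def norm_smul)
    finally show ?thesis .
  qed
  moreover have "(\<lambda>m. \<Psi> m x) \<longlonglongrightarrow> 0" for x
  proof -
    have "(\<lambda>m. Complex (\<psi> m x / 2) (- \<psi> m (smul \<i> x) / 2)) \<longlonglongrightarrow> Complex (0 / 2) (- 0 / 2)"
      using \<psi>(2) by (intro tendsto_intros) auto
    then show ?thesis by (simp add: \<Psi>_def zero_complex.code)
  qed
  moreover have "\<exists>y. norm y \<le> 1 \<and> norm (\<Psi> m y) \<ge> \<delta> / 2" for m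
  proof -
    obtain y where "norm y \<le> 1" "\<bar>\<psi> m y\<bar> \<ge> \<delta>" using \<psi>(4) by blast
    moreover have "\<bar>\<psi> m y\<bar> / 2 \<le> norm (\<Psi> m y)"
      using abs_Re_le_cmod[of "\<Psi> m y"] by (simp add: \<Psi>_def)
    ultimately show ?thesis by (intro exI[of _ y]) auto
  qed
  ultimately show "\<not> symmetric_forms_sequential_weak_star_KK smul n"
    using \<Psi> \<psi>(3) assms sm
    by (intro not_sequential_weak_star_KK_if_weak_star_null[where cj = cnj and \<psi> = \<Psi> and \<delta> = "\<delta> / 2"])
      (auto simp: complex_norm_square mult.commute simp del: of_real_power)
qed

end
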